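(* Let $\mathbb{K}$ be an algebraically closed field of characteristic $\neq 2$ and let $\alpha_1,\alpha_2\in\mathbb{K}$. The algebra $\mathcal{D}_3(\alpha_1,\alpha_2)$ is a PBW deformation of the Fomin--Kirillov algebra $\mathcal{E}_3$, and the elements $$(a-b)^{n_1}a^{n_2}c^{n_3},\qquad 0\leq n_1\leq 2,\quad 0\leq n_2,n_3\leq 1,$$ form a basis of $\mathcal{D}_3(\alpha_1,\alpha_2)$ as a $\mathbb{K}$-vector space.
   Context: $\mathcal{D}_3(\alpha_1,\alpha_2)$ denotes the associative unital $\mathbb{K}$-algebra given by generators $a,b,c$ and relations $$a^2=b^2=c^2=\alpha_1,\qquad ca+bc+ab=\alpha_2,\qquad cb+ba+ac=\alpha_2.$$ The Fomin--Kirillov algebra is $\mathcal{E}_3=\mathcal{D}_3(0,0)$, i.e. the algebra with generators $a,b,c$ and relations $a^2=b^2=c^2=0$, $ca+bc+ab=0$, $cb+ba+ac=0$; it is $\mathbb{N}_0$-graded with $a,b,c$ of degree $1$. A PBW deformation of an $\mathbb{N}_0$-graded algebra $A$ is an $\mathbb{N}_0$-filtered algebra $D$ such that the associated graded algebra $\mathrm{gr}\,D$ is isomorphic to $A$ (as a graded algebra). Here $\mathcal{D}_3(\alpha_1,\alpha_2)$ carries the filtration by degree in the generators: the $m$-th filtration piece is spanned by the words of length at most $m$ in $a,b,c$. *)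

theory Defs
  imports
    "HOL-Library.Poly_Mapping"
    "HOL-Computational_Algebra.Polynomial"
    "HOL-Algebra.QuotRing"
    "Jordan_Normal_Form.VS_Connect"
begin

section \<open>Filtered and graded associative algebras\<close>

text \<open>The locale \<^locale>\<open>algebra\<close> of HOL-Algebra requires a commutative multiplication.\<close>

locale assoc_algebra = vectorspace K A + A?: ring A for K and A (structure) +
  assumes smult_mult_left:
      "\<lbrakk>k \<in> carrier K; x \<in> carrier A; y \<in> carrier A\<rbrakk>
        \<Longrightarrow> (k \<odot>\<^bsub>A\<^esub> x) \<otimes>\<^bsub>A\<^esub> y = k \<odot>\<^bsub>A\<^esub> (x \<otimes>\<^bsub>A\<^esub> y)"
    and smult_mult_right:
      "\<lbrakk>k \<in> carrier K; x \<in> carrier A; y \<in> carrier A\<rbrakk>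
        \<Longrightarrow> x \<otimes>\<^bsub>A\<^esub> (k \<odot>\<^bsub>A\<^esub> y) = k \<odot>\<^bsub>A\<^esub> (x \<otimes>\<^bsub>A\<^esub> y)"

locale graded_algebra = assoc_algebra K A for K and A (structure) +
  fixes G :: "nat \<Rightarrow> _ set"
  assumes component_subspace: "VectorSpace.subspace K (G n) A"
    and direct_sum: "x \<in> carrier A \<Longrightarrow>
      \<exists>!f. (\<forall>n. f n \<in> G n) \<and> finite {n. f n \<noteq> \<zero>\<^bsub>A\<^esub>} \<and>
           x = (\<Oplus>\<^bsub>A\<^esub> n \<in> {n. f n \<noteq> \<zero>\<^bsub>A\<^esub>}. f n)"
    and one_component: "\<one>\<^bsub>A\<^esub> \<in> G 0"
    and mult_component: "\<lbrakk>x \<in> G m; y \<in> G n\<rbrakk> \<Longrightarrow> x \<otimes>\<^bsub>A\<^esub> y \<in> G (m + n)"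

locale filtered_algebra = assoc_algebra K D for K and D (structure) +
  fixes F :: "nat \<Rightarrow> _ set"
  assumes piece_subspace: "VectorSpace.subspace K (F n) D"
    and piece_mono: "F n \<subseteq> F (Suc n)"
    and exhaustive: "(\<Union>n. F n) = carrier D"
    and one_piece: "\<one>\<^bsub>D\<^esub> \<in> F 0"
    and mult_piece: "\<lbrakk>x \<in> F m; y \<in> F n\<rbrakk> \<Longrightarrow> x \<otimes>\<^bsub>D\<^esub> y \<in> F (m + n)"

definition quotient_algebra :: "('k, 'a) module \<Rightarrow> 'a set \<Rightarrow> ('k, 'a set) module" where
  "quotient_algebra A I =
    \<lparr>carrier = carrier (A Quot I), mult = mult (A Quot I), one = \<one>\<^bsub>A Quot I\<^esub>,
     zero = \<zero>\<^bsub>A Quot I\<^esub>, add = add (A Quot I),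
     smult = (\<lambda>k X. \<Union>x\<in>X. I +>\<^bsub>A\<^esub> (k \<odot>\<^bsub>A\<^esub> x))\<rparr>"

definition graded_iso ::
  "('k, 'r) ring_scheme \<Rightarrow> ('k, 'a) module \<Rightarrow> (nat \<Rightarrow> 'a set) \<Rightarrow>
    ('k, 'b) module \<Rightarrow> (nat \<Rightarrow> 'b set) \<Rightarrow> ('a \<Rightarrow> 'b) set" where
  "graded_iso K A G B H =
    {\<phi> \<in> ring_iso A B \<inter> LinearCombinations.module_hom K A B. \<forall>n. \<phi> ` G n = H n}"


section \<open>The associated graded algebra\<close>

definition filt_pred :: "('k, 'a) module \<Rightarrow> (nat \<Rightarrow> 'a set) \<Rightarrow> nat \<Rightarrow> 'a set" where
  "filt_pred D F n = (case n of 0 \<Rightarrow> {\<zero>\<^bsub>D\<^esub>} | Suc m \<Rightarrow> F m)"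

text \<open>The component \<open>F\<^sub>n / F\<^sub>n\<^sub>-\<^sub>1\<close>, with \<open>F\<^sub>-\<^sub>1 = 0\<close>. Only its vector space structure is
  meaningful: the multiplicative fields of the record are not used.\<close>

definition gr_component ::
  "('k, 'a) module \<Rightarrow> (nat \<Rightarrow> 'a set) \<Rightarrow> nat \<Rightarrow> ('k, 'a set) module" where
  "gr_component D F n = quotient_algebra (D\<lparr>carrier := F n\<rparr>) (filt_pred D F n)"

text \<open>Elements of \<open>gr D\<close> are finitely supported sequences of cosets, the \<open>n\<close>-th one in
  \<open>F\<^sub>n / F\<^sub>n\<^sub>-\<^sub>1\<close>. The product of \<open>x + F\<^sub>i\<^sub>-\<^sub>1\<close> and \<open>y + F\<^sub>j\<^sub>-\<^sub>1\<close> is \<open>xy + F\<^sub>i\<^sub>+\<^sub>j\<^sub>-\<^sub>1\<close>, obtained from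
  \<^const>\<open>rcoset_mult\<close> modulo \<open>F\<^sub>i\<^sub>+\<^sub>j\<^sub>-\<^sub>1\<close>.\<close>

definition assoc_graded ::
  "('k, 'a) module \<Rightarrow> (nat \<Rightarrow> 'a set) \<Rightarrow> ('k, nat \<Rightarrow> 'a set) module" where
  "assoc_graded D F =
    \<lparr>carrier = {s. (\<forall>n. s n \<in> carrier (gr_component D F n)) \<and>
                   finite {n. s n \<noteq> \<zero>\<^bsub>gr_component D F n\<^esub>}},
     mult = (\<lambda>s t n. \<Oplus>\<^bsub>gr_component D F n\<^esub> i \<in> {..n}.
                       rcoset_mult D (filt_pred D F n) (s i) (t (n - i))),
     one = (\<lambda>n. if n = 0 then filt_pred D F 0 +>\<^bsub>D\<^esub> \<one>\<^bsub>D\<^esub> else \<zero>\<^bsub>gr_component D F n\<^esub>),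
     zero = (\<lambda>n. \<zero>\<^bsub>gr_component D F n\<^esub>),
     add = (\<lambda>s t n. s n \<oplus>\<^bsub>gr_component D F n\<^esub> t n),
     smult = (\<lambda>k s n. k \<odot>\<^bsub>gr_component D F n\<^esub> s n)\<rparr>"

definition assoc_graded_grading ::
  "('k, 'a) module \<Rightarrow> (nat \<Rightarrow> 'a set) \<Rightarrow> nat \<Rightarrow> (nat \<Rightarrow> 'a set) set" where
  "assoc_graded_grading D F n =
    {s \<in> carrier (assoc_graded D F). \<forall>m. m \<noteq> n \<longrightarrow> s m = \<zero>\<^bsub>gr_component D F m\<^esub>}"

definition pbw_deformation ::
  "('k, 'r) ring_scheme \<Rightarrow> ('k, 'a) module \<Rightarrow> (nat \<Rightarrow> 'a set) \<Rightarrow>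
    ('k, 'b) module \<Rightarrow> (nat \<Rightarrow> 'b set) \<Rightarrow> bool" where
  "pbw_deformation K A G D F \<longleftrightarrow>
    graded_algebra K A G \<and> filtered_algebra K D F \<and>
    graded_iso K (assoc_graded D F) (assoc_graded_grading D F) A G \<noteq> {}"


section \<open>Free algebras\<close>

text \<open>The free monoid is written additively, so that the finitely supported functions from it to a
  field, with their convolution product from \<^theory>\<open>HOL-Library.Poly_Mapping\<close>, are the free
  associative algebra.\<close>

datatype 'x free_mon = Word (letters: "'x list")

instantiation free_mon :: (type) monoid_add
begin

definition zero_free_mon :: "'a free_mon" where
  "0 = Word []"

definition plus_free_mon :: "'a free_mon \<Rightarrow> 'a free_mon \<Rightarrow> 'a free_mon" where
  "u + v = Word (letters u @ letters v)"

instance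
  by standard (simp_all add: zero_free_mon_def plus_free_mon_def)

end

definition free_algebra :: "('k::field, 'x free_mon \<Rightarrow>\<^sub>0 'k) module" where
  "free_algebra =
    \<lparr>carrier = UNIV, mult = (*), one = 1, zero = 0, add = (+),
     smult = (\<lambda>k. Poly_Mapping.map ((*) k))\<rparr>"

definition free_gen :: "'x \<Rightarrow> ('x free_mon \<Rightarrow>\<^sub>0 'k::field)" where
  "free_gen x = Poly_Mapping.single (Word [x]) 1"

definition free_const :: "'k \<Rightarrow> ('x free_mon \<Rightarrow>\<^sub>0 'k::field)" where
  "free_const k = Poly_Mapping.single 0 k"

definition word_prod :: "('k, 'a) module \<Rightarrow> ('x \<Rightarrow> 'a) \<Rightarrow> 'x list \<Rightarrow> 'a" where
  "word_prod A g w = foldr (\<lambda>x y. g x \<otimes>\<^bsub>A\<^esub> y) w \<one>\<^bsub>A\<^esub>"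


section \<open>The algebras \<open>D\<^sub>3(\<alpha>\<^sub>1, \<alpha>\<^sub>2)\<close> and the Fomin--Kirillov algebra\<close>

datatype gen3 = Gen_a | Gen_b | Gen_c

definition D3_relators :: "'k::field \<Rightarrow> 'k \<Rightarrow> (gen3 free_mon \<Rightarrow>\<^sub>0 'k) set" where
  "D3_relators \<alpha>\<^sub>1 \<alpha>\<^sub>2 =
    (let a = free_gen Gen_a; b = free_gen Gen_b; c = free_gen Gen_c
     in {a * a - free_const \<alpha>\<^sub>1, b * b - free_const \<alpha>\<^sub>1, c * c - free_const \<alpha>\<^sub>1,
         c * a + b * c + a * b - free_const \<alpha>\<^sub>2,
         c * b + b * a + a * c - free_const \<alpha>\<^sub>2})"

definition D3_ideal :: "'k::field \<Rightarrow> 'k \<Rightarrow> (gen3 free_mon \<Rightarrow>\<^sub>0 'k) set" where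
  "D3_ideal \<alpha>\<^sub>1 \<alpha>\<^sub>2 = Idl\<^bsub>free_algebra\<^esub> (D3_relators \<alpha>\<^sub>1 \<alpha>\<^sub>2)"

definition D3 :: "'k::field \<Rightarrow> 'k \<Rightarrow> ('k, (gen3 free_mon \<Rightarrow>\<^sub>0 'k) set) module" where
  "D3 \<alpha>\<^sub>1 \<alpha>\<^sub>2 = quotient_algebra free_algebra (D3_ideal \<alpha>\<^sub>1 \<alpha>\<^sub>2)"

definition D3_gen :: "'k::field \<Rightarrow> 'k \<Rightarrow> gen3 \<Rightarrow> (gen3 free_mon \<Rightarrow>\<^sub>0 'k) set" where
  "D3_gen \<alpha>\<^sub>1 \<alpha>\<^sub>2 x = D3_ideal \<alpha>\<^sub>1 \<alpha>\<^sub>2 +>\<^bsub>free_algebra\<^esub> free_gen x"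

definition D3_filtration ::
  "'k::field \<Rightarrow> 'k \<Rightarrow> nat \<Rightarrow> (gen3 free_mon \<Rightarrow>\<^sub>0 'k) set set" where
  "D3_filtration \<alpha>\<^sub>1 \<alpha>\<^sub>2 m =
    LinearCombinations.module.span class_ring (D3 \<alpha>\<^sub>1 \<alpha>\<^sub>2)
      (word_prod (D3 \<alpha>\<^sub>1 \<alpha>\<^sub>2) (D3_gen \<alpha>\<^sub>1 \<alpha>\<^sub>2) ` {w. length w \<le> m})"

definition E3 :: "('k::field, (gen3 free_mon \<Rightarrow>\<^sub>0 'k) set) module" where
  "E3 = D3 0 0"

definition E3_grading :: "nat \<Rightarrow> (gen3 free_mon \<Rightarrow>\<^sub>0 'k::field) set set" where
  "E3_grading m =
    LinearCombinations.module.span class_ring E3 (word_prod E3 (D3_gen 0 0) ` {w. length w = m})"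

end

theory Submission
  imports Defs
begin

text \<open>Rewriting with \<open>x = a - b\<close> brings every element of the algebra to a combination of the twelve
  elements \<open>x\<^sup>i a\<^sup>j c\<^sup>k\<close>. Left multiplication on their formal span is given by explicit operators
  that satisfy the defining relations, so the free algebra acts on this span, and applying an
  element to the basis vector \<open>1\<close> yields its normal form coordinates: these vanish exactly on the
  ideal of relations, which gives the basis. The operators raise the degree by at most one, and
  their degree one part is the operator for \<open>\<alpha>\<^sub>1 = \<alpha>\<^sub>2 = 0\<close>. Hence the leading forms of the ideal of
  \<open>D\<^sub>3(\<alpha>\<^sub>1, \<alpha>\<^sub>2)\<close> are exactly the homogeneous elements of the ideal of \<open>E\<^sub>3\<close>, which is the PBW
  property.\<close>

section \<open>Homogeneous parts in the free algebra\<close>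

text \<open>Rewriting alone only proves spanning. Independence needs a lower bound on the algebra;
  instead of resolving the overlaps of the rewriting rules, the five relators are checked on
  explicit operators, a finite computation with free parameters. The choice \<open>x = a - b\<close>
  keeps the operators short: \<open>a^2 = b^2\<close> amounts to \<open>a x + x a = x^2\<close>, so
  \<open>x^2\<close> commutes with \<open>a\<close>, and a similar computation shows that it
  commutes with \<open>c\<close>. Hence moving \<open>a\<close> or \<open>c\<close> past
  \<open>x^i\<close> deviates from plain commutation only for \<open>i = 1\<close>. The bound
  \<open>i \<le> 2\<close> stems from the deformed braid relation
  \<open>a b a - b a b = \<alpha>\<^sub>2 (a - b)\<close>, a consequence of the squares and of
  \<open>c a + b c + a b = \<alpha>\<^sub>2\<close>; expanding \<open>(a - b)^3\<close> turns it
  into \<open>x^3 = (3 \<alpha>\<^sub>1 - \<alpha>\<^sub>2) x\<close>. For the PBW property, the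
  associated graded algebra and the Fomin-Kirillov algebra are both images of the free algebra, and
  it suffices that the two surjections have the same kernel.\<close>

lemma poly_mapping_expand: "t = (\<Sum>w\<in>Poly_Mapping.keys t. Poly_Mapping.single w (Poly_Mapping.lookup t w))"
proof (rule poly_mapping_eqI)
  fix v
  have "Poly_Mapping.lookup (\<Sum>w\<in>Poly_Mapping.keys t. Poly_Mapping.single w (Poly_Mapping.lookup t w)) v
      = (\<Sum>w\<in>Poly_Mapping.keys t. if w = v then Poly_Mapping.lookup t w else 0)"
    by (auto simp: lookup_sum lookup_single when_def intro!: sum.cong)
  also have "\<dots> = Poly_Mapping.lookup t v"
    by (simp add: sum.delta in_keys_iff)
  finally show "Poly_Mapping.lookup t v = Poly_Mapping.lookup (\<Sum>w\<in>Poly_Mapping.keys t. Poly_Mapping.single w (Poly_Mapping.lookup t w)) v"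
    by simp
qed

text \<open>No separate case for zero is required, since a monomial with coefficient 0 is zero. The
  monomial case exposes the word as a list, so that products of monomials become
  concatenations.\<close>

lemma free_algebra_induct [case_names monomial add]:
  fixes t :: "'x free_mon \<Rightarrow>\<^sub>0 'k::comm_monoid_add"
  assumes monomial: "\<And>w k. P (Poly_Mapping.single (Word w) k)"
    and add: "\<And>s t. P s \<Longrightarrow> P t \<Longrightarrow> P (s + t)"
  shows "P t"
proof -
  have "P (\<Sum>w\<in>A. Poly_Mapping.single w (f w))" if "finite A" for A and f :: "'x free_mon \<Rightarrow> 'k"
    using that
  proof induction
    case empty
    show ?case using monomial[of "[]" 0] by simp
  next
    case (insert w A)
    show ?case using insert add monomial[of "letters w" "f w"] by simp
  qed
  then show ?thesis
    using poly_mapping_expand[of t] by (metis finite_keys)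
qed

lemma letters_zero [simp]: "letters 0 = []"
  by (simp add: zero_free_mon_def)

lemma letters_plus [simp]: "letters (u + v) = letters u @ letters v"
  by (simp add: plus_free_mon_def)

lemma single_Word_mult:
  "Poly_Mapping.single (Word u) j * Poly_Mapping.single (Word v) k
    = Poly_Mapping.single (Word (u @ v)) (j * k :: 'k::semiring_0)"
  by (simp add: mult_single plus_free_mon_def)

lemma lookup_free_const_mult [simp]:
  "Poly_Mapping.lookup (free_const k * t) w = k * Poly_Mapping.lookup t w"
  by (simp add: free_const_def mult_map_scale_conv_mult[symmetric] map.rep_eq when_def)

lemma free_const_0 [simp]: "free_const 0 = 0"
  by (simp add: free_const_def)

lemma free_const_1 [simp]: "free_const 1 = 1"
  by (simp add: free_const_def)

lemma free_const_add: "free_const (j + k) = free_const j + free_const k"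
  by (simp add: free_const_def single_add)

lemma free_const_diff: "free_const (j - k) = free_const j - free_const k"
  by (simp add: free_const_def single_diff)

lemma free_const_uminus: "free_const (- k) = - free_const k"
  by (simp add: free_const_def single_uminus)

lemma free_const_mult: "free_const (j * k) = free_const j * free_const k"
  by (simp add: free_const_def mult_single)

lemma free_const_commute: "t * free_const k = free_const k * (t :: 'x free_mon \<Rightarrow>\<^sub>0 'k::field)"
  by (induction t rule: free_algebra_induct)
    (simp_all add: free_const_def zero_free_mon_def single_Word_mult mult.commute distrib_left distrib_right)

lemma single_eq_free_const_mult:
  "Poly_Mapping.single w k = free_const k * Poly_Mapping.single w 1"
  by (simp add: free_const_def mult_single)

definition hpart :: "nat \<Rightarrow> ('x free_mon \<Rightarrow>\<^sub>0 'k::zero) \<Rightarrow> ('x free_mon \<Rightarrow>\<^sub>0 'k)" where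
  "hpart n = Poly_Mapping.mapp (\<lambda>w c. if length (letters w) = n then c else 0)"

definition homog :: "nat \<Rightarrow> ('x free_mon \<Rightarrow>\<^sub>0 'k::zero) set" where
  "homog n = {t. \<forall>w\<in>Poly_Mapping.keys t. length (letters w) = n}"

text \<open>The bound is strict so that \<open>deg_lt n\<close> corresponds to the piece of index n
  - 1 of the filtration for every n, including n = 0, where \<open>deg_lt 0 = {0}\<close> matches
  the convention that the piece before the first one is zero.\<close>

definition deg_lt :: "nat \<Rightarrow> ('x free_mon \<Rightarrow>\<^sub>0 'k::zero) set" where
  "deg_lt n = {t. \<forall>w\<in>Poly_Mapping.keys t. length (letters w) < n}"

lemma homog_iff: "t \<in> homog n \<longleftrightarrow> (\<forall>w. length (letters w) \<noteq> n \<longrightarrow> Poly_Mapping.lookup t w = 0)"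
  by (auto simp: homog_def in_keys_iff)

lemma deg_lt_iff: "t \<in> deg_lt n \<longleftrightarrow> (\<forall>w. n \<le> length (letters w) \<longrightarrow> Poly_Mapping.lookup t w = 0)"
  by (auto simp: deg_lt_def in_keys_iff not_less[symmetric])

lemma lookup_hpart:
  "Poly_Mapping.lookup (hpart n t) w = (if length (letters w) = n then Poly_Mapping.lookup t w else 0)"
  by (simp add: hpart_def lookup_mapp when_def in_keys_iff)

lemma hpart_zero [simp]: "hpart n 0 = 0"
  by (rule poly_mapping_eqI) (simp add: lookup_hpart)

lemma hpart_add: "hpart n (s + t) = hpart n s + hpart n t"
  by (rule poly_mapping_eqI) (simp add: lookup_hpart lookup_add)

lemma hpart_diff: "hpart n (s - t) = hpart n s - hpart n (t :: _ \<Rightarrow>\<^sub>0 'k::ab_group_add)"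
  by (rule poly_mapping_eqI) (simp add: lookup_hpart lookup_minus)

lemma hpart_sum: "hpart n (sum f A) = (\<Sum>i\<in>A. hpart n (f i))"
  by (induction A rule: infinite_finite_induct) (simp_all add: hpart_add)

lemma hpart_free_const_mult: "hpart n (free_const k * t) = free_const k * hpart n t"
  by (rule poly_mapping_eqI) (simp add: lookup_hpart)

lemma hpart_homog: "t \<in> homog m \<Longrightarrow> hpart n t = (if n = m then t else 0)"
  by (auto intro!: poly_mapping_eqI simp: lookup_hpart homog_iff)

lemma hpart_in_homog [simp]: "hpart n t \<in> homog n"
  by (simp add: homog_iff lookup_hpart)

lemma homog_subset_deg_lt: "homog n \<subseteq> deg_lt (Suc n)"
  by (auto simp: homog_iff deg_lt_iff)

lemma homog_zero [simp]: "0 \<in> homog n"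
  by (simp add: homog_iff)

lemma homog_add: "s \<in> homog n \<Longrightarrow> t \<in> homog n \<Longrightarrow> s + t \<in> homog n"
  by (simp add: homog_iff lookup_add)

lemma homog_diff: "s \<in> homog n \<Longrightarrow> t \<in> homog n \<Longrightarrow> s - t \<in> homog n"
  for t :: "_ \<Rightarrow>\<^sub>0 'k::ab_group_add"
  by (simp add: homog_iff lookup_minus)

lemma homog_free_const_mult: "t \<in> homog n \<Longrightarrow> free_const k * t \<in> homog n"
  by (simp add: homog_iff)

lemma homog_mult:
  "s \<in> homog m \<Longrightarrow> t \<in> homog n \<Longrightarrow> s * t \<in> homog (m + n)" for t :: "_ \<Rightarrow>\<^sub>0 'k::semiring_0"
  using keys_mult[of s t] by (fastforce simp: homog_def)

lemma homog_single [simp]: "Poly_Mapping.single w k \<in> homog n \<longleftrightarrow> k = 0 \<or> length (letters w) = n"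
  by (auto simp: homog_def)

lemma deg_lt_zero [simp]: "0 \<in> deg_lt n"
  by (simp add: deg_lt_iff)

lemma deg_lt_0 [simp]: "deg_lt 0 = {0}"
  by (auto simp: deg_lt_iff intro: poly_mapping_eqI)

lemma deg_lt_add: "s \<in> deg_lt n \<Longrightarrow> t \<in> deg_lt n \<Longrightarrow> s + t \<in> deg_lt n"
  by (simp add: deg_lt_iff lookup_add)

lemma deg_lt_diff: "s \<in> deg_lt n \<Longrightarrow> t \<in> deg_lt n \<Longrightarrow> s - t \<in> deg_lt n"
  for t :: "_ \<Rightarrow>\<^sub>0 'k::ab_group_add"
  by (simp add: deg_lt_iff lookup_minus)

lemma deg_lt_sum: "(\<And>i. i \<in> A \<Longrightarrow> f i \<in> deg_lt n) \<Longrightarrow> sum f A \<in> deg_lt n"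
  by (induction A rule: infinite_finite_induct) (simp_all add: deg_lt_add)

lemma deg_lt_free_const_mult: "t \<in> deg_lt n \<Longrightarrow> free_const k * t \<in> deg_lt n"
  by (simp add: deg_lt_iff)

lemma deg_lt_mono: "m \<le> n \<Longrightarrow> deg_lt m \<subseteq> deg_lt n"
  by (auto simp: deg_lt_iff)

text \<open>Degrees at most m - 1 and n - 1 add up to at most m + n - 2, which has to be below l;
  writing this as \<open>m + n \<le> Suc l\<close> avoids truncated subtraction.\<close>

lemma deg_lt_mult:
  fixes s t :: "'x free_mon \<Rightarrow>\<^sub>0 'k::semiring_0"
  assumes "s \<in> deg_lt m" "t \<in> deg_lt n" "m + n \<le> Suc l"
  shows "s * t \<in> deg_lt l"
  using keys_mult[of s t] assms by (fastforce simp: deg_lt_def)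

lemma deg_lt_single [simp]: "Poly_Mapping.single w k \<in> deg_lt n \<longleftrightarrow> k = 0 \<or> length (letters w) < n"
  by (auto simp: deg_lt_def)

lemma diff_hpart_in_deg_lt:
  "t \<in> deg_lt (Suc n) \<Longrightarrow> t - hpart n t \<in> deg_lt n" for t :: "_ \<Rightarrow>\<^sub>0 'k::ab_group_add"
  by (auto simp: deg_lt_iff lookup_minus lookup_hpart)

lemma hpart_deg_lt: "t \<in> deg_lt m \<Longrightarrow> m \<le> n \<Longrightarrow> hpart n t = 0"
  by (auto intro!: poly_mapping_eqI simp: lookup_hpart deg_lt_iff)

lemma deg_lt_exhaustive: "\<exists>n. t \<in> deg_lt n"
proof -
  have "t \<in> deg_lt (Suc (Max (insert 0 ((\<lambda>w. length (letters w)) ` Poly_Mapping.keys t))))"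
    by (auto simp: deg_lt_def less_Suc_eq_le)
  then show ?thesis ..
qed

lemma sum_hpart: "t \<in> deg_lt n \<Longrightarrow> (\<Sum>i<n. hpart i t) = t"
  by (rule poly_mapping_eqI) (auto simp: lookup_sum lookup_hpart deg_lt_iff)

text \<open>Both sides are additive in each factor, which reduces the claim to two monomials; there
  at most one summand survives, the one with i equal to the length of the first word.\<close>

lemma hpart_mult:
  "hpart n (s * t) = (\<Sum>i\<le>n. hpart i s * hpart (n - i) t)" for s t :: "'x free_mon \<Rightarrow>\<^sub>0 'k::comm_ring"
proof (induction s rule: free_algebra_induct)
  case (monomial u j)
  show ?case
  proof (induction t rule: free_algebra_induct)
    case (monomial v k)
    have "hpart i (Poly_Mapping.single (Word u) j) * hpart (n - i) (Poly_Mapping.single (Word v) k) =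
        (if i = length u then (if n - length u = length v then
          Poly_Mapping.single (Word u) j * Poly_Mapping.single (Word v) k else 0) else 0)" for i
      using hpart_homog[of "Poly_Mapping.single (Word u) j" "length u"]
        hpart_homog[of "Poly_Mapping.single (Word v) k" "length v"] by simp
    moreover have "hpart n (Poly_Mapping.single (Word (u @ v)) (j * k)) =
        (if n = length u + length v then Poly_Mapping.single (Word (u @ v)) (j * k) else 0)"
      using hpart_homog[of "Poly_Mapping.single (Word (u @ v)) (j * k)" "length u + length v"] by simp
    ultimately show ?case
      by (auto simp: single_Word_mult)
  qed (simp add: distrib_left hpart_add sum.distrib)
qed (simp add: distrib_right hpart_add sum.distrib)

section \<open>Algebras presented by a free algebra\<close>

text \<open>Surjectivity of \<open>h\<close> and its compatibility with the operations are all that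
  is required of the record \<open>D\<close>: the axioms of an algebra are then inherited from the
  free algebra. The ideal of relations occurs only through equations \<open>h t = h 0\<close>, so
  \<open>D3\<close> for arbitrary parameters and \<open>E3\<close> are instances of the same
  setting.\<close>

locale presentation =
  fixes D :: "('k::field, 'b) module" (structure)
    and h :: "('x free_mon \<Rightarrow>\<^sub>0 'k) \<Rightarrow> 'b"
  assumes carrier_eq: "carrier D = range h"
    and zero_eq: "\<zero> = h 0"
    and one_eq: "\<one> = h 1"
    and add_h: "h s \<oplus> h t = h (s + t)"
    and mult_h: "h s \<otimes> h t = h (s * t)"
    and smult_h: "k \<odot>\<^bsub>D\<^esub> h t = h (free_const k * t)"
begin

lemma h_closed [simp]: "h t \<in> carrier D"
  by (simp add: carrier_eq)

lemma abelian_group: "abelian_group D"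
proof (rule abelian_groupI)
  fix x assume "x \<in> carrier D"
  then obtain t where "x = h t" by (auto simp: carrier_eq)
  then show "\<exists>y\<in>carrier D. y \<oplus> x = \<zero>"
    by (intro bexI[of _ "h (- t)"]) (simp_all add: add_h zero_eq)
qed (auto simp: carrier_eq zero_eq add_h add_ac)

lemma ring: "ring D"
proof (rule ringI)
  show "Group.monoid D"
    by (rule monoidI) (auto simp: carrier_eq one_eq mult_h mult.assoc)
qed (use abelian_group in \<open>auto simp: carrier_eq add_h mult_h distrib_left distrib_right\<close>)

lemma module: "module class_ring D"
  by (rule moduleI)
    (use abelian_group class_cring.cring_axioms in
      \<open>auto simp: carrier_eq add_h smult_h distrib_left distrib_right free_const_add free_const_mult mult.assoc\<close>)

lemma assoc_algebra: "assoc_algebra class_ring D"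
proof -
  have "vectorspace class_ring D"
    by (simp add: vectorspace_def module class_field)
  then show ?thesis
    using ring
    by (simp add: assoc_algebra_def assoc_algebra_axioms_def)
      (auto simp: carrier_eq smult_h mult_h mult.assoc free_const_commute simp flip: mult.assoc)
qed

sublocale assoc_algebra class_ring D
  by (rule assoc_algebra)

lemma minus_h: "h s \<ominus> h t = h (s - t)"
proof -
  have "h (s - t) \<oplus> h t = h s" by (simp add: add_h)
  then show ?thesis
    using abelian_group
    by (metis h_closed add.inv_solve_right minus_eq)
qed

lemma h_eq_iff: "h s = h t \<longleftrightarrow> h (s - t) = h 0"
proof
  assume "h s = h t"
  then have "h s \<oplus> h (- t) = h t \<oplus> h (- t)" by simp
  then show "h (s - t) = h 0" by (simp add: add_h)
next
  assume "h (s - t) = h 0"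
  then have "h (s - t) \<oplus> h t = h 0 \<oplus> h t" by simp
  then show "h s = h t" by (simp add: add_h)
qed

lemma pow_h: "h t [^] (n::nat) = h (t ^ n)"
  by (induction n) (simp_all add: one_eq mult_h power_commutes)

lemma finsum_h: "finite A \<Longrightarrow> (\<Oplus>i\<in>A. h (f i)) = h (\<Sum>i\<in>A. f i)"
  by (induction A rule: finite_induct) (simp_all add: zero_eq add_h)

lemma h_eq_word_prod: "h (Poly_Mapping.single (Word w) 1) = word_prod D (\<lambda>x. h (free_gen x)) w"
proof (induction w)
  case Nil
  show ?case
    by (simp add: word_prod_def one_eq flip: zero_free_mon_def)
next
  case (Cons x w)
  have "h (Poly_Mapping.single (Word (x # w)) 1) = h (free_gen x) \<otimes> h (Poly_Mapping.single (Word w) 1)"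
    by (simp add: mult_h free_gen_def single_Word_mult)
  then show ?case
    by (simp add: Cons.IH) (simp add: word_prod_def)
qed

definition linear_closed :: "('x free_mon \<Rightarrow>\<^sub>0 'k) set \<Rightarrow> bool" where
  "linear_closed S \<longleftrightarrow> 0 \<in> S \<and> (\<forall>s\<in>S. \<forall>t\<in>S. s + t \<in> S) \<and> (\<forall>k. \<forall>s\<in>S. free_const k * s \<in> S)"

lemma submodule_image:
  assumes "linear_closed S"
  shows "submodule class_ring (h ` S) D"
  using assms module
  by (auto simp: submodule_def linear_closed_def zero_eq add_h smult_h)

lemma subspace_image:
  assumes "linear_closed S"
  shows "VectorSpace.subspace class_ring (h ` S) D"
  using submodule_image[OF assms] vectorspace_axioms by (simp add: subspace_def)

text \<open>Membership in \<open>S\<close> is a condition \<open>P\<close> on the words that occur,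
  so \<open>S\<close> is the span of its monomials and \<open>h\<close> carries this over to
  \<open>D\<close>. Taking length at most n or length equal to n for \<open>P\<close> gives the
  filtration and the grading.\<close>

lemma span_word_prod:
  assumes linear: "linear_closed S"
    and S: "\<And>t. t \<in> S \<longleftrightarrow> (\<forall>w\<in>Poly_Mapping.keys t. P (letters w))"
  shows "LinearCombinations.module.span class_ring D (word_prod D (\<lambda>x. h (free_gen x)) ` {w. P w}) = h ` S"
proof
  let ?B = "word_prod D (\<lambda>x. h (free_gen x)) ` {w. P w}"
  have B: "?B = (\<lambda>w. h (Poly_Mapping.single (Word w) 1)) ` {w. P w}"
    by (simp add: h_eq_word_prod)
  have "?B \<subseteq> h ` S"
    unfolding B by (auto simp: S)
  then show "span ?B \<subseteq> h ` S"
    by (intro span_is_subset submodule_image linear)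
  have carr: "?B \<subseteq> carrier D"
    unfolding B by auto
  have sub: "submodule class_ring (span ?B) D"
    by (rule span_is_submodule[OF carr])
  have "h (\<Sum>w\<in>A. Poly_Mapping.single w (f w)) \<in> span ?B"
    if "finite A" "\<forall>w\<in>A. P (letters w)" for A f
    using that
  proof induction
    case empty
    show ?case using submodule.zero_closed[OF sub] by (simp add: zero_eq)
  next
    case (insert w A)
    have "h (Poly_Mapping.single w 1) \<in> ?B"
      unfolding B using insert.prems by (intro image_eqI[of _ _ "letters w"]) auto
    then have "h (Poly_Mapping.single w 1) \<in> span ?B"
      using in_own_span[OF carr] by blast
    then have "f w \<odot>\<^bsub>D\<^esub> h (Poly_Mapping.single w 1) \<in> span ?B"
      by (intro submodule.smult_closed[OF sub]) simp_all
    then have "h (Poly_Mapping.single w (f w)) \<in> span ?B"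
      by (simp add: smult_h single_eq_free_const_mult[of w "f w"])
    then show ?case
      using insert submodule.m_closed[OF sub] by (simp flip: add_h)
  qed
  note * = this
  have "h t \<in> span ?B" if "t \<in> S" for t
    using *[of "Poly_Mapping.keys t" "Poly_Mapping.lookup t"] that
    by (simp add: S flip: poly_mapping_expand)
  then show "h ` S \<subseteq> span ?B"
    by blast
qed

lemma linear_closed_homog: "linear_closed (homog n)"
  by (simp add: linear_closed_def homog_add homog_free_const_mult)

lemma linear_closed_deg_lt: "linear_closed (deg_lt n)"
  by (simp add: linear_closed_def deg_lt_add deg_lt_free_const_mult)

lemma span_words_eq:
  "LinearCombinations.module.span class_ring D (word_prod D (\<lambda>x. h (free_gen x)) ` {w. length w = n}) = h ` homog n"
  by (rule span_word_prod[OF linear_closed_homog]) (simp add: homog_def)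

lemma span_words_le:
  "LinearCombinations.module.span class_ring D (word_prod D (\<lambda>x. h (free_gen x)) ` {w. length w \<le> n}) = h ` deg_lt (Suc n)"
  by (rule span_word_prod[OF linear_closed_deg_lt]) (simp add: deg_lt_def less_Suc_eq_le)

lemma filtered_algebra: "filtered_algebra class_ring D (\<lambda>n. h ` deg_lt (Suc n))"
proof (intro filtered_algebra.intro filtered_algebra_axioms.intro assoc_algebra)
  fix n
  show "VectorSpace.subspace class_ring (h ` deg_lt (Suc n)) D"
    by (rule subspace_image[OF linear_closed_deg_lt])
  show "h ` deg_lt (Suc n) \<subseteq> h ` deg_lt (Suc (Suc n))"
    by (intro image_mono deg_lt_mono) simp
next
  have "(1 :: 'x free_mon \<Rightarrow>\<^sub>0 'k) \<in> deg_lt (Suc 0)"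
    by (simp add: deg_lt_def)
  then show "\<one> \<in> h ` deg_lt (Suc 0)"
    by (simp add: one_eq)
next
  show "(\<Union>n. h ` deg_lt (Suc n)) = carrier D"
  proof -
    have "\<exists>n. t \<in> deg_lt (Suc n)" for t :: "'x free_mon \<Rightarrow>\<^sub>0 'k"
      using deg_lt_exhaustive[of t] deg_lt_mono[of _ "Suc _"] by (meson le_SucI order_refl subsetD)
    then show ?thesis
      unfolding carrier_eq by fast
  qed
next
  fix x y m n
  assume "x \<in> h ` deg_lt (Suc m)" "y \<in> h ` deg_lt (Suc n)"
  then show "x \<otimes> y \<in> h ` deg_lt (Suc (m + n))"
    using deg_lt_mult[of _ "Suc m" _ "Suc n" "Suc (m + n)"] by (auto simp: mult_h intro!: imageI)
qed

lemma finsum_components: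
  assumes "finite A" "\<And>n. n \<in> A \<Longrightarrow> f n = h (u n)"
  shows "(\<Oplus>n\<in>A. f n) = h (\<Sum>n\<in>A. u n)"
proof -
  have "(\<Oplus>n\<in>A. f n) = (\<Oplus>n\<in>A. h (u n))"
    by (rule finsum_cong') (auto simp: assms)
  then show ?thesis by (simp add: finsum_h assms(1))
qed

text \<open>The homogeneous parts of any representative give a decomposition. The assumption that
  the kernel contains the homogeneous parts of its elements is what makes the decomposition
  unique.\<close>

lemma graded_algebra:
  assumes hom: "\<And>t n. h t = \<zero> \<Longrightarrow> h (hpart n t) = \<zero>"
  shows "graded_algebra class_ring D (\<lambda>n. h ` homog n)"
proof (intro graded_algebra.intro graded_algebra_axioms.intro assoc_algebra)
  fix x assume "x \<in> carrier D"
  then obtain t where x: "x = h t" by (auto simp: carrier_eq)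
  obtain N where N: "t \<in> deg_lt N" using deg_lt_exhaustive by blast
  show "\<exists>!f. (\<forall>n. f n \<in> h ` homog n) \<and> finite {n. f n \<noteq> \<zero>} \<and> x = (\<Oplus>n\<in>{n. f n \<noteq> \<zero>}. f n)"
  proof (rule ex1I)
    let ?f = "\<lambda>n. h (hpart n t)"
    have sub: "{n. ?f n \<noteq> \<zero>} \<subseteq> {..<N}"
      using hpart_deg_lt[OF N] by (auto simp: zero_eq not_less[symmetric] intro: ccontr)
    then have fin: "finite {n. ?f n \<noteq> \<zero>}" by (rule finite_subset) simp
    have "x = (\<Oplus>n\<in>{..<N}. ?f n)"
      by (simp add: finsum_h sum_hpart[OF N] x)
    also have "\<dots> = (\<Oplus>n\<in>{n. ?f n \<noteq> \<zero>}. ?f n)"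
      using sub by (intro add.finprod_mono_neutral_cong_right) auto
    finally show "(\<forall>n. ?f n \<in> h ` homog n) \<and> finite {n. ?f n \<noteq> \<zero>} \<and> x = (\<Oplus>n\<in>{n. ?f n \<noteq> \<zero>}. ?f n)"
      using fin by simp
  next
    fix f assume f: "(\<forall>n. f n \<in> h ` homog n) \<and> finite {n. f n \<noteq> \<zero>} \<and> x = (\<Oplus>n\<in>{n. f n \<noteq> \<zero>}. f n)"
    then have "\<forall>n. \<exists>u. u \<in> homog n \<and> f n = h u" by blast
    then obtain u where u: "\<And>n. u n \<in> homog n" "\<And>n. f n = h (u n)" by metis
    define A where "A = {n. f n \<noteq> \<zero>}"
    have A: "finite A" using f by (simp add: A_def)
    have "h t = h (\<Sum>n\<in>A. u n)"
      using f finsum_components[OF A, of f u] u(2) by (simp add: x A_def)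
    \<comment> \<open>Two representatives of the same element differ by an element of the kernel,
      and \<open>hom\<close> allows the comparison degree by degree.\<close>
    then have "h (t - (\<Sum>n\<in>A. u n)) = \<zero>" using h_eq_iff zero_eq by metis
    then have *: "h (hpart n t) = h (hpart n (\<Sum>n\<in>A. u n))" for n
      using hom[of "t - (\<Sum>n\<in>A. u n)" n] h_eq_iff by (simp add: hpart_diff zero_eq)
    show "f = (\<lambda>n. h (hpart n t))"
    proof
      fix n
      have "hpart n (\<Sum>n\<in>A. u n) = (if n \<in> A then u n else 0)"
        using A by (simp add: hpart_sum hpart_homog[OF u(1)])
      then show "f n = h (hpart n t)"
        unfolding * using u(2) by (auto simp: A_def zero_eq)
    qed
  qed
next
  show "\<one> \<in> h ` homog 0"
    by (simp add: one_eq homog_def)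
qed (use subspace_image[OF linear_closed_homog] in \<open>auto simp: mult_h homog_mult\<close>)

end

section \<open>The associated graded algebra of a presented algebra\<close>

context presentation
begin

abbreviation filtration :: "nat \<Rightarrow> 'b set" where
  "filtration n \<equiv> h ` deg_lt (Suc n)"

text \<open>The coset of \<open>h t\<close> modulo the piece of index n - 1. It is defined for all
  \<open>t\<close>, but it is an element of the n-th component of the associated graded algebra only
  if some representative of it has degree at most n.\<close>

definition symb :: "nat \<Rightarrow> ('x free_mon \<Rightarrow>\<^sub>0 'k) \<Rightarrow> 'b set" where
  "symb n t = (\<lambda>s. h (s + t)) ` deg_lt n"

lemma filt_pred_filtration: "filt_pred D filtration n = h ` deg_lt n"
  by (cases n) (simp_all add: filt_pred_def zero_eq)

lemma coset_h: "(h ` deg_lt n) +> h t = symb n t"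
  by (auto simp: a_r_coset_def r_coset_def symb_def add_h)

lemma symb_eq_iff: "symb n s = symb n t \<longleftrightarrow> (\<exists>u\<in>deg_lt n. h s = h (u + t))"
proof
  assume "symb n s = symb n t"
  moreover have "h (0 + s) \<in> symb n s"
    unfolding symb_def by (rule imageI) simp
  ultimately show "\<exists>u\<in>deg_lt n. h s = h (u + t)"
    by (auto simp: symb_def)
next
  assume "\<exists>u\<in>deg_lt n. h s = h (u + t)"
  then obtain u where u: "u \<in> deg_lt n" "h s = h (u + t)" by blast
  have "h (v + s) = h ((v + u) + t)" "h (v + t) = h ((v - u) + s)" for v
    by (simp_all add: add_h[of _ s, symmetric] u add.assoc) (simp_all add: add_h)
  with u show "symb n s = symb n t"
    unfolding symb_def using deg_lt_add[OF _ u(1)] deg_lt_diff[OF _ u(1)] by blast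
qed

lemma symb_cong: "s - t \<in> deg_lt n \<Longrightarrow> symb n s = symb n t"
  unfolding symb_eq_iff by (rule bexI[of _ "s - t"]) simp_all

lemma symb_hpart: "t \<in> deg_lt (Suc n) \<Longrightarrow> symb n t = symb n (hpart n t)"
  by (rule symb_cong) (rule diff_hpart_in_deg_lt)

lemma carrier_gr_component: "carrier (gr_component D filtration n) = symb n ` deg_lt (Suc n)"
proof -
  have "carrier (gr_component D filtration n) = (\<Union>x\<in>filtration n. {(h ` deg_lt n) +> x})"
    by (simp add: gr_component_def quotient_algebra_def FactRing_def A_RCOSETS_def RCOSETS_def
        filt_pred_filtration a_r_coset_def r_coset_def)
  then show ?thesis by (auto simp: coset_h)
qed

lemma zero_gr_component: "\<zero>\<^bsub>gr_component D filtration n\<^esub> = symb n 0"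
  by (simp add: gr_component_def quotient_algebra_def FactRing_def filt_pred_filtration symb_def)

lemma add_gr_component: "symb n s \<oplus>\<^bsub>gr_component D filtration n\<^esub> symb n t = symb n (s + t)"
proof -
  have "symb n s \<oplus>\<^bsub>gr_component D filtration n\<^esub> symb n t = (\<Union>x\<in>symb n s. \<Union>y\<in>symb n t. {x \<oplus> y})"
    by (simp add: gr_component_def quotient_algebra_def FactRing_def set_add_def set_mult_def)
  also have "\<dots> = (\<Union>u\<in>deg_lt n. \<Union>v\<in>deg_lt n. {h ((u + v) + (s + t))})"
    by (auto simp: symb_def add_h ac_simps)
  also have "\<dots> = symb n (s + t)"
    unfolding symb_def
    by (auto simp: deg_lt_add) (metis add_0_right deg_lt_zero)
  finally show ?thesis .
qed

lemma smult_gr_component: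
  "k \<odot>\<^bsub>gr_component D filtration n\<^esub> symb n t = symb n (free_const k * t)"
proof -
  have "k \<odot>\<^bsub>gr_component D filtration n\<^esub> symb n t = (\<Union>x\<in>symb n t. (h ` deg_lt n) +> (k \<odot>\<^bsub>D\<^esub> x))"
    by (simp add: gr_component_def quotient_algebra_def filt_pred_filtration a_r_coset_def r_coset_def)
  also have "\<dots> = (\<Union>u\<in>deg_lt n. symb n (free_const k * (u + t)))"
    by (simp add: symb_def smult_h coset_h)
  \<comment> \<open>Another representative changes \<open>free_const k * t\<close> only in degree
    below n, so all cosets in the union coincide; the index set contains 0, hence the union is this
    one coset.\<close>
  also have "\<dots> = (\<Union>u\<in>deg_lt n :: ('x free_mon \<Rightarrow>\<^sub>0 'k) set. symb n (free_const k * t))"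
    by (intro SUP_cong refl symb_cong) (simp add: distrib_left deg_lt_free_const_mult)
  also have "\<dots> = symb n (free_const k * t)"
    using deg_lt_zero[of n] by blast
  finally show ?thesis .
qed

text \<open>Changing the representatives to u + s and v + t alters the product by u (v + t) + s v.
  One factor in each summand has dropped below its degree bound, so the change has degree below i +
  j.\<close>

lemma rcoset_mult_symb:
  assumes s: "s \<in> deg_lt (Suc i)" and t: "t \<in> deg_lt (Suc j)"
  shows "rcoset_mult D (filt_pred D filtration (i + j)) (symb i s) (symb j t) = symb (i + j) (s * t)"
proof -
  have "symb (i + j) ((u + s) * (v + t)) = symb (i + j) (s * t)" if "u \<in> deg_lt i" "v \<in> deg_lt j" for u v
  proof (rule symb_cong)
    have "(u + s) * (v + t) - s * t = u * (v + t) + s * v"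
      by (simp add: algebra_simps)
    moreover have "v + t \<in> deg_lt (Suc j)"
      using that t deg_lt_mono[of j "Suc j"] by (intro deg_lt_add) auto
    ultimately show "(u + s) * (v + t) - s * t \<in> deg_lt (i + j)"
      using that s by (auto intro!: deg_lt_add deg_lt_mult[of u i "v + t" "Suc j"] deg_lt_mult[of s "Suc i" v j])
  qed
  then have "rcoset_mult D (filt_pred D filtration (i + j)) (symb i s) (symb j t)
      = (\<Union>u\<in>deg_lt i :: ('x free_mon \<Rightarrow>\<^sub>0 'k) set. \<Union>v\<in>deg_lt j :: ('x free_mon \<Rightarrow>\<^sub>0 'k) set. symb (i + j) (s * t))"
    by (simp add: rcoset_mult_def filt_pred_filtration symb_def[of i] symb_def[of j] mult_h coset_h)
  also have "\<dots> = symb (i + j) (s * t)"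
    using deg_lt_zero[of i] deg_lt_zero[of j] by blast
  finally show ?thesis .
qed

lemma abelian_monoid_gr_component: "abelian_monoid (gr_component D filtration n)"
  by (rule abelian_monoidI)
    (auto simp: carrier_gr_component add_gr_component zero_gr_component deg_lt_add add_ac)

lemma finsum_gr_component:
  assumes "finite A" "\<And>i. i \<in> A \<Longrightarrow> f i \<in> deg_lt (Suc n)"
  shows "(\<Oplus>\<^bsub>gr_component D filtration n\<^esub>i\<in>A. symb n (f i)) = symb n (\<Sum>i\<in>A. f i)"
proof -
  interpret gr: abelian_monoid "gr_component D filtration n"
    by (rule abelian_monoid_gr_component)
  show ?thesis using assms
  proof (induction A rule: finite_induct)
    case (insert i A)
    have "(\<Oplus>\<^bsub>gr_component D filtration n\<^esub>i\<in>insert i A. symb n (f i))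
        = symb n (f i) \<oplus>\<^bsub>gr_component D filtration n\<^esub> (\<Oplus>\<^bsub>gr_component D filtration n\<^esub>i\<in>A. symb n (f i))"
      using insert by (intro gr.finsum_insert) (auto simp: carrier_gr_component)
    then show ?case using insert by (simp add: add_gr_component)
  qed (simp add: zero_gr_component)
qed

text \<open>This map exhibits the associated graded algebra as another quotient of the free algebra:
  the lemmas below show that it is surjective and compatible with all operations. It splits
  \<open>t\<close> into homogeneous parts and takes the symbol of each part in its own
  degree.\<close>

definition symbols :: "('x free_mon \<Rightarrow>\<^sub>0 'k) \<Rightarrow> nat \<Rightarrow> 'b set" where
  "symbols t = (\<lambda>n. symb n (hpart n t))"

lemma hpart_in_deg_lt [simp]: "hpart n t \<in> deg_lt (Suc n)"
  using homog_subset_deg_lt hpart_in_homog by blast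

lemma carrier_assoc_graded: "carrier (assoc_graded D filtration) = range symbols"
proof
  show "range symbols \<subseteq> carrier (assoc_graded D filtration)"
  proof
    fix s assume "s \<in> range symbols"
    then obtain t where s: "s = symbols t" by blast
    obtain N where "t \<in> deg_lt N" using deg_lt_exhaustive by blast
    then have "{n. symb n (hpart n t) \<noteq> symb n 0} \<subseteq> {..<N}"
      using hpart_deg_lt by (metis (mono_tags, lifting) lessThan_iff mem_Collect_eq not_less subsetI)
    then have "finite {n. symb n (hpart n t) \<noteq> symb n 0}"
      by (rule finite_subset) simp
    then show "s \<in> carrier (assoc_graded D filtration)"
      by (simp add: s assoc_graded_def symbols_def carrier_gr_component zero_gr_component)
  qed
  show "carrier (assoc_graded D filtration) \<subseteq> range symbols"
  proof
    fix s assume "s \<in> carrier (assoc_graded D filtration)"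
    then have mem: "\<forall>n. \<exists>t. t \<in> deg_lt (Suc n) \<and> s n = symb n t" and fin: "finite {n. s n \<noteq> symb n 0}"
      by (auto simp: assoc_graded_def carrier_gr_component zero_gr_component)
    obtain u where u: "\<And>n. u n \<in> deg_lt (Suc n)" "\<And>n. s n = symb n (u n)"
      using mem by metis
    define A where "A = {n. s n \<noteq> symb n 0}"
    \<comment> \<open>Only the part of degree n of the representative \<open>u n\<close> matters for
      its coset. Summing these parts over the finite support therefore yields one preimage for the
      whole sequence.\<close>
    have "symbols (\<Sum>n\<in>A. hpart n (u n)) n = s n" for n
    proof -
      have "hpart n (\<Sum>n\<in>A. hpart n (u n)) = (if n \<in> A then hpart n (u n) else 0)"
        using fin by (simp add: hpart_sum hpart_homog[OF hpart_in_homog] A_def)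
      then show ?thesis
        using u by (auto simp: symbols_def symb_hpart[OF u(1), symmetric] A_def)
    qed
    then show "s \<in> range symbols"
      by (intro image_eqI[of _ _ "\<Sum>n\<in>A. hpart n (u n)"]) auto
  qed
qed

lemma one_assoc_graded: "\<one>\<^bsub>assoc_graded D filtration\<^esub> = symbols 1"
proof -
  have "hpart n 1 = (if n = 0 then 1 else 0 :: 'x free_mon \<Rightarrow>\<^sub>0 'k)" for n
    by (rule hpart_homog) (simp add: homog_def)
  then show ?thesis
    by (intro ext)
      (simp add: assoc_graded_def symbols_def zero_gr_component filt_pred_filtration one_eq coset_h
        del: deg_lt_0)
qed

lemma add_assoc_graded: "symbols s \<oplus>\<^bsub>assoc_graded D filtration\<^esub> symbols t = symbols (s + t)"
  by (simp add: assoc_graded_def symbols_def add_gr_component hpart_add)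

lemma smult_assoc_graded: "k \<odot>\<^bsub>assoc_graded D filtration\<^esub> symbols t = symbols (free_const k * t)"
  by (simp add: assoc_graded_def symbols_def smult_gr_component hpart_free_const_mult)

lemma mult_assoc_graded: "symbols s \<otimes>\<^bsub>assoc_graded D filtration\<^esub> symbols t = symbols (s * t)"
proof
  fix n
  let ?G = "gr_component D filtration n"
  interpret gr: abelian_monoid ?G
    by (rule abelian_monoid_gr_component)
  have prod: "rcoset_mult D (filt_pred D filtration n) (symb i (hpart i s)) (symb (n - i) (hpart (n - i) t))
      = symb n (hpart i s * hpart (n - i) t)" if "i \<le> n" for i
    using rcoset_mult_symb[of "hpart i s" i "hpart (n - i) t" "n - i"] that by simp
  have deg: "hpart i s * hpart (n - i) t \<in> deg_lt (Suc n)" if "i \<le> n" for i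
    by (rule deg_lt_mult[of _ "Suc i" _ "Suc (n - i)"]) (use that in simp_all)
  have "(symbols s \<otimes>\<^bsub>assoc_graded D filtration\<^esub> symbols t) n
      = (\<Oplus>\<^bsub>?G\<^esub>i\<in>{..n}. rcoset_mult D (filt_pred D filtration n) (symb i (hpart i s)) (symb (n - i) (hpart (n - i) t)))"
    by (simp add: assoc_graded_def symbols_def)
  also have "\<dots> = (\<Oplus>\<^bsub>?G\<^esub>i\<in>{..n}. symb n (hpart i s * hpart (n - i) t))"
    by (rule gr.finsum_cong') (auto simp: prod deg carrier_gr_component)
  also have "\<dots> = symb n (hpart n (s * t))"
    by (subst finsum_gr_component) (use deg in \<open>auto simp: hpart_mult\<close>)
  finally show "(symbols s \<otimes>\<^bsub>assoc_graded D filtration\<^esub> symbols t) n = symbols (s * t) n"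
    by (simp add: symbols_def)
qed

lemma assoc_graded_grading_eq: "assoc_graded_grading D filtration n = symbols ` homog n"
proof
  show "symbols ` homog n \<subseteq> assoc_graded_grading D filtration n"
  proof
    fix s assume "s \<in> symbols ` homog n"
    then obtain t where "s = symbols t" "t \<in> homog n" by blast
    moreover from this have "symbols t m = symb m 0" if "m \<noteq> n" for m
      using that by (simp add: symbols_def hpart_homog)
    ultimately show "s \<in> assoc_graded_grading D filtration n"
      by (simp add: assoc_graded_grading_def carrier_assoc_graded zero_gr_component)
  qed
  show "assoc_graded_grading D filtration n \<subseteq> symbols ` homog n"
  proof
    fix s assume "s \<in> assoc_graded_grading D filtration n"
    then obtain t where s: "s = symbols t" and zero: "\<And>m. m \<noteq> n \<Longrightarrow> symbols t m = symb m 0"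
      by (auto simp: assoc_graded_grading_def carrier_assoc_graded zero_gr_component)
    have "s = symbols (hpart n t)"
      by (rule ext) (use zero in \<open>auto simp: s symbols_def hpart_homog[OF hpart_in_homog]\<close>)
    then show "s \<in> symbols ` homog n" by simp
  qed
qed

end

text \<open>Assumption \<open>leading\<close> says that a homogeneous element of degree n has zero
  symbol exactly if it lies in the kernel of \<open>g\<close>. Since the kernel of \<open>g\<close>
  is homogeneous, it agrees with the kernel of \<open>symbols\<close>, and two surjective
  homomorphisms with the same kernel have isomorphic images.\<close>

theorem pbw_deformation_presentation:
  fixes D :: "('k::field, 'b) module" and A :: "('k, 'a) module"
    and h :: "('x free_mon \<Rightarrow>\<^sub>0 'k) \<Rightarrow> 'b" and g :: "('x free_mon \<Rightarrow>\<^sub>0 'k) \<Rightarrow> 'a"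
  assumes D: "presentation D h" and A: "presentation A g"
    and homogeneous: "\<And>t n. g t = g 0 \<Longrightarrow> g (hpart n t) = g 0"
    and leading: "\<And>t n. t \<in> homog n \<Longrightarrow> (\<exists>s\<in>deg_lt n. h t = h s) \<longleftrightarrow> g t = g 0"
  shows "pbw_deformation class_ring A (\<lambda>n. g ` homog n) D (\<lambda>n. h ` deg_lt (Suc n))"
proof -
  interpret D: presentation D h by (rule D)
  interpret A: presentation A g by (rule A)
  let ?gr = "assoc_graded D D.filtration"
  have kernel: "D.symbols s = D.symbols t \<longleftrightarrow> g s = g t" for s t
  proof -
    have "D.symb n (hpart n s) = D.symb n (hpart n t) \<longleftrightarrow> g (hpart n (s - t)) = g 0" for n
    proof -
      have "h (hpart n s) = h (u + hpart n t) \<longleftrightarrow> h (hpart n (s - t)) = h u" for u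
        using D.h_eq_iff[of "hpart n s" "u + hpart n t"] D.h_eq_iff[of "hpart n (s - t)" u]
        by (simp add: hpart_diff algebra_simps)
      then show ?thesis
        unfolding D.symb_eq_iff using leading[of "hpart n (s - t)" n] by simp
    qed
    then have "D.symbols s = D.symbols t \<longleftrightarrow> (\<forall>n. g (hpart n (s - t)) = g 0)"
      by (simp add: D.symbols_def fun_eq_iff)
    also have "\<dots> \<longleftrightarrow> g (s - t) = g 0"
    proof
      assume *: "\<forall>n. g (hpart n (s - t)) = g 0"
      obtain N where "s - t \<in> deg_lt N" using deg_lt_exhaustive by blast
      then have "g (s - t) = g (\<Sum>i<N. hpart i (s - t))" by (simp add: sum_hpart)
      also have "\<dots> = (\<Oplus>\<^bsub>A\<^esub>i\<in>{..<N}. g (hpart i (s - t)))" by (simp add: A.finsum_h)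
      also have "\<dots> = g 0" using * by (simp add: A.finsum_zero flip: A.zero_eq)
      finally show "g (s - t) = g 0" .
    qed (use homogeneous in blast)
    also have "\<dots> \<longleftrightarrow> g s = g t" by (simp add: A.h_eq_iff[of s t])
    finally show ?thesis .
  qed
  \<comment> \<open>An arbitrary preimage may be chosen, because \<open>kernel\<close> shows that
    its value under \<open>g\<close> depends only on \<open>s\<close>.\<close>
  define \<phi> where "\<phi> s = g (SOME t. D.symbols t = s)" for s
  have \<phi>: "\<phi> (D.symbols t) = g t" for t
    unfolding \<phi>_def using someI[of "\<lambda>u. D.symbols u = D.symbols t" t] kernel by blast
  have "\<phi> \<in> Ring.ring_hom ?gr A"
    by (rule ring_hom_memI)
      (auto simp: D.carrier_assoc_graded D.mult_assoc_graded D.add_assoc_graded D.one_assoc_graded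
        \<phi> A.mult_h A.add_h A.one_eq)
  moreover have "bij_betw \<phi> (carrier ?gr) (carrier A)"
    by (rule bij_betw_imageI)
      (auto simp: D.carrier_assoc_graded A.carrier_eq \<phi> kernel inj_on_def image_image)
  moreover have "\<phi> \<in> LinearCombinations.module_hom class_ring ?gr A"
    by (auto simp: LinearCombinations.module_hom_def D.carrier_assoc_graded D.add_assoc_graded D.smult_assoc_graded
        \<phi> A.add_h A.smult_h)
  moreover have "\<phi> ` assoc_graded_grading D D.filtration n = g ` homog n" for n
    by (simp add: D.assoc_graded_grading_eq image_image \<phi>)
  ultimately have "\<phi> \<in> graded_iso class_ring ?gr (assoc_graded_grading D D.filtration) A (\<lambda>n. g ` homog n)"
    by (simp add: graded_iso_def ring_iso_def)
  then show ?thesis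
    using A.graded_algebra homogeneous D.filtered_algebra
    by (auto simp: pbw_deformation_def A.zero_eq)
qed

section \<open>Bases obtained from dual coordinate functionals\<close>

context presentation
begin

text \<open>The functionals \<open>coord\<close> descend to \<open>D\<close> by
  \<open>coord_cong\<close> and are dual to the family \<open>e\<close> by \<open>coord_sum\<close>,
  which gives independence. By \<open>kernel\<close> they separate the elements of \<open>D\<close>,
  so each element equals the combination formed with its own coordinates, which gives
  spanning.\<close>

lemma basis_by_coordinates:
  assumes fin: "finite J"
    and kernel: "\<And>t. (\<forall>j\<in>J. coord t j = 0) \<Longrightarrow> h t = h 0"
    and coord_cong: "\<And>s t j. h s = h t \<Longrightarrow> j \<in> J \<Longrightarrow> coord s j = coord t j"
    and coord_diff: "\<And>s t j. coord (s - t) j = coord s j - (coord t j :: 'k)"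
    and coord_sum: "\<And>p i. i \<in> J \<Longrightarrow> coord (\<Sum>j\<in>J. free_const (p j) * e j) i = p i"
  shows "inj_on (\<lambda>j. h (e j)) J \<and> basis ((\<lambda>j. h (e j)) ` J)"
proof -
  let ?B = "(\<lambda>j. h (e j)) ` J"
  have inj: "inj_on (\<lambda>j. h (e j)) J"
  proof (rule inj_onI)
    fix i j assume ij: "i \<in> J" "j \<in> J" "h (e i) = h (e j)"
    \<comment> \<open>Duality on single members of the family is \<open>coord_sum\<close> for
      coefficients that form a Kronecker delta.\<close>
    have "coord (e k) i = (if i = k then 1 else 0)" if "k \<in> J" for k
    proof -
      have "(\<Sum>j\<in>J. free_const (if j = k then 1 else 0) * e j) = e k"
      proof -
        have "(\<Sum>j\<in>J. free_const (if j = k then 1 else 0) * e j) = (\<Sum>j\<in>J. if j = k then e j else 0)"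
          by (rule sum.cong) auto
        then show ?thesis using fin that by simp
      qed
      then show ?thesis using coord_sum[OF \<open>i \<in> J\<close>, of "\<lambda>j. if j = k then 1 else 0"] by simp
    qed
    then show "i = j"
      using ij coord_cong[OF ij(3) ij(1)] by (metis zero_neq_one)
  qed
  have B: "finite ?B" "?B \<subseteq> carrier D"
    using fin by auto
  have lincomb: "lincomb a ?B = h (\<Sum>j\<in>J. free_const (a (h (e j))) * e j)" for a
  proof -
    have "lincomb a ?B = (\<Oplus>j\<in>J. a (h (e j)) \<odot>\<^bsub>D\<^esub> h (e j))"
      unfolding lincomb_def by (rule finsum_reindex) (use inj in \<open>auto simp: smult_h\<close>)
    then show ?thesis by (simp add: smult_h finsum_h fin)
  qed
  have "lin_indpt ?B"
  proof (rule finite_lin_indpt2[OF B])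
    fix a :: "'b \<Rightarrow> 'k"
    assume "lincomb a ?B = \<zero>"
    then have "h (\<Sum>j\<in>J. free_const (a (h (e j))) * e j) = h 0"
      by (simp add: lincomb zero_eq)
    then have "a (h (e i)) = coord 0 i" if "i \<in> J" for i
      using coord_cong[OF _ that] coord_sum[OF that] by metis
    moreover have "coord 0 i = 0" for i
      using coord_diff[of 0 0 i] by simp
    ultimately show "\<forall>v\<in>?B. a v = \<zero>\<^bsub>class_ring\<^esub>"
      by auto
  qed
  moreover have "span ?B = carrier D"
  proof
    show "span ?B \<subseteq> carrier D"
      by (rule submodule.subset[OF span_is_submodule[OF B(2)]])
    show "carrier D \<subseteq> span ?B"
    proof
      fix x assume "x \<in> carrier D"
      then obtain t where x: "x = h t" by (auto simp: carrier_eq)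
      \<comment> \<open>Coefficients of a linear combination are indexed by the vectors themselves,
        so the coordinates have to be transported along the inverse of the injective family.\<close>
      define a where "a v = coord t (the_inv_into J (\<lambda>j. h (e j)) v)" for v
      have "lincomb a ?B = h (\<Sum>j\<in>J. free_const (coord t j) * e j)"
        by (simp add: lincomb a_def the_inv_into_f_f[OF inj])
      moreover have "h (t - (\<Sum>j\<in>J. free_const (coord t j) * e j)) = h 0"
        by (rule kernel) (simp add: coord_diff coord_sum)
      ultimately have "x = lincomb a ?B"
        using h_eq_iff x by metis
      then show "x \<in> span ?B"
        unfolding finite_span[OF B] by auto
    qed
  qed
  ultimately show ?thesis
    using inj B(2) by (simp add: basis_def)
qed

end

section \<open>Quotients of the free algebra\<close>

lemma ring_free_algebra: "ring free_algebra"
proof (rule ringI)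
  show "abelian_group free_algebra"
    by (rule abelian_groupI)
      (auto simp: free_algebra_def add_ac intro: exI[of _ "- x" for x])
  show "Group.monoid free_algebra"
    by (rule monoidI) (auto simp: free_algebra_def mult.assoc)
qed (auto simp: free_algebra_def distrib_left distrib_right)

lemma ideal_free_algebraI:
  fixes I :: "('x free_mon \<Rightarrow>\<^sub>0 'k::field) set"
  assumes "0 \<in> I" "\<And>s t. s \<in> I \<Longrightarrow> t \<in> I \<Longrightarrow> s - t \<in> I"
    and "\<And>s t. t \<in> I \<Longrightarrow> s * t \<in> I" "\<And>s t. t \<in> I \<Longrightarrow> t * s \<in> I"
  shows "ideal I free_algebra"
proof (rule idealI[OF ring_free_algebra])
  have uminus: "\<ominus>\<^bsub>free_algebra\<^esub> t = - t" for t :: "'x free_mon \<Rightarrow>\<^sub>0 'k"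
    by (rule abelian_group.minus_equality[OF ring.is_abelian_group[OF ring_free_algebra]])
      (simp_all add: free_algebra_def)
  have neg: "- t \<in> I" if "t \<in> I" for t
    using assms(2)[OF assms(1) that] by simp
  show "subgroup I (add_monoid free_algebra)"
  proof (rule group.subgroupI)
    show "Group.group (add_monoid free_algebra)"
      using ring.is_abelian_group[OF ring_free_algebra] by (rule abelian_group.a_group)
    fix s t assume "s \<in> I" "t \<in> I"
    then show "s \<otimes>\<^bsub>add_monoid free_algebra\<^esub> t \<in> I"
      using assms(2)[of s "- t"] neg[of t] by (simp add: free_algebra_def)
  qed (use assms(1) neg uminus in \<open>auto simp: a_inv_def[symmetric]\<close>, simp add: free_algebra_def)
qed (use assms in \<open>auto simp: free_algebra_def\<close>)

context
  fixes I :: "('x free_mon \<Rightarrow>\<^sub>0 'k::field) set"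
  assumes I: "ideal I free_algebra"
begin

interpretation ideal I free_algebra by (rule I)

lemma ideal_free_algebra_zero: "0 \<in> I"
  using additive_subgroup.zero_closed[OF is_additive_subgroup] by (simp add: free_algebra_def)

lemma ideal_free_algebra_add: "s \<in> I \<Longrightarrow> t \<in> I \<Longrightarrow> s + t \<in> I"
  using additive_subgroup.a_closed[OF is_additive_subgroup, of s t] by (simp add: free_algebra_def)

lemma ideal_free_algebra_mult_left: "t \<in> I \<Longrightarrow> s * t \<in> I"
  using I_l_closed[of t s] by (simp add: free_algebra_def)

lemma ideal_free_algebra_mult_right: "t \<in> I \<Longrightarrow> t * s \<in> I"
  using I_r_closed[of t s] by (simp add: free_algebra_def)

lemma ideal_free_algebra_diff: "s \<in> I \<Longrightarrow> t \<in> I \<Longrightarrow> s - t \<in> I"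
  using ideal_free_algebra_add[of s "- t"] ideal_free_algebra_mult_left[of t "- 1"] by simp

lemma coset_free_algebra: "I +>\<^bsub>free_algebra\<^esub> t = (\<lambda>s. s + t) ` I"
  by (auto simp: a_r_coset_def r_coset_def free_algebra_def)

lemma coset_free_algebra_eq_iff:
  "I +>\<^bsub>free_algebra\<^esub> s = I +>\<^bsub>free_algebra\<^esub> t \<longleftrightarrow> s - t \<in> I"
proof
  assume "I +>\<^bsub>free_algebra\<^esub> s = I +>\<^bsub>free_algebra\<^esub> t"
  moreover have "0 + s \<in> I +>\<^bsub>free_algebra\<^esub> s"
    unfolding coset_free_algebra by (rule imageI) (rule ideal_free_algebra_zero)
  ultimately show "s - t \<in> I" by (auto simp: coset_free_algebra)
next
  assume st: "s - t \<in> I"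
  have "u + s = (u + (s - t)) + t" "u + t = (u - (s - t)) + s" for u by simp_all
  then show "I +>\<^bsub>free_algebra\<^esub> s = I +>\<^bsub>free_algebra\<^esub> t"
    unfolding coset_free_algebra
    using ideal_free_algebra_add[OF _ st] ideal_free_algebra_diff[OF _ st] by blast
qed

lemma presentation_quotient_algebra:
  "presentation (quotient_algebra free_algebra I) (\<lambda>t. I +>\<^bsub>free_algebra\<^esub> t)"
proof
  let ?Q = "quotient_algebra free_algebra I"
  note defs = quotient_algebra_def FactRing_def
  show "carrier ?Q = range (\<lambda>t. I +>\<^bsub>free_algebra\<^esub> t)"
    unfolding defs A_RCOSETS_def RCOSETS_def a_r_coset_def by (simp add: free_algebra_def) blast
  show "\<zero>\<^bsub>?Q\<^esub> = I +>\<^bsub>free_algebra\<^esub> 0"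
    by (simp add: defs coset_free_algebra)
  show "\<one>\<^bsub>?Q\<^esub> = I +>\<^bsub>free_algebra\<^esub> 1"
    by (simp add: defs) (simp add: free_algebra_def)
  fix s t
  have carr: "u \<in> carrier free_algebra" for u :: "'x free_mon \<Rightarrow>\<^sub>0 'k"
    by (simp add: free_algebra_def)
  show "(I +>\<^bsub>free_algebra\<^esub> s) \<oplus>\<^bsub>?Q\<^esub> (I +>\<^bsub>free_algebra\<^esub> t) = I +>\<^bsub>free_algebra\<^esub> (s + t)"
    using a_rcos_sum[OF carr carr, of s t] by (simp add: defs) (simp add: free_algebra_def)
  show "(I +>\<^bsub>free_algebra\<^esub> s) \<otimes>\<^bsub>?Q\<^esub> (I +>\<^bsub>free_algebra\<^esub> t) = I +>\<^bsub>free_algebra\<^esub> (s * t)"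
    using rcoset_mult_add[OF carr carr, of s t] by (simp add: defs) (simp add: free_algebra_def)
  fix k
  have "k \<odot>\<^bsub>?Q\<^esub> (I +>\<^bsub>free_algebra\<^esub> t) = (\<Union>u\<in>I. I +>\<^bsub>free_algebra\<^esub> (free_const k * (u + t)))"
    by (simp add: quotient_algebra_def coset_free_algebra[of t])
      (simp add: free_algebra_def mult_map_scale_conv_mult free_const_def)
  also have "\<dots> = (\<Union>u\<in>I. I +>\<^bsub>free_algebra\<^esub> (free_const k * t))"
    by (intro SUP_cong refl)
      (simp add: coset_free_algebra_eq_iff ideal_free_algebra_mult_left flip: right_diff_distrib)
  also have "\<dots> = I +>\<^bsub>free_algebra\<^esub> (free_const k * t)"
    using ideal_free_algebra_zero by blast
  finally show "k \<odot>\<^bsub>?Q\<^esub> (I +>\<^bsub>free_algebra\<^esub> t) = I +>\<^bsub>free_algebra\<^esub> (free_const k * t)" .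
qed

end

section \<open>Modules over the free algebra\<close>

text \<open>By the universal property of the free algebra, any family of linear operators extends to
  an action; no relations are imposed at this stage. The first letter of a word acts last, which
  makes \<open>act\<close> a left module structure.\<close>

locale free_module =
  fixes L :: "'x \<Rightarrow> ('i \<Rightarrow> 'k::field) \<Rightarrow> 'i \<Rightarrow> 'k"
  assumes L_add: "L x (\<lambda>i. v i + w i) = (\<lambda>i. L x v i + L x w i)"
    and L_scale: "L x (\<lambda>i. k * v i) = (\<lambda>i. k * L x v i)"
begin

definition act :: "('x free_mon \<Rightarrow>\<^sub>0 'k) \<Rightarrow> ('i \<Rightarrow> 'k) \<Rightarrow> 'i \<Rightarrow> 'k" where
  "act t v i = (\<Sum>w\<in>Poly_Mapping.keys t. Poly_Mapping.lookup t w * foldr L (letters w) v i)"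

lemma act_superset:
  assumes "finite A" "Poly_Mapping.keys t \<subseteq> A"
  shows "act t v i = (\<Sum>w\<in>A. Poly_Mapping.lookup t w * foldr L (letters w) v i)"
  unfolding act_def by (rule sum.mono_neutral_left) (use assms in \<open>auto simp: in_keys_iff\<close>)

lemma act_plus: "act (s + t) v = (\<lambda>i. act s v i + act t v i)"
proof
  fix i
  let ?A = "Poly_Mapping.keys s \<union> Poly_Mapping.keys t"
  show "act (s + t) v i = act s v i + act t v i"
    using act_superset[of ?A s v i] act_superset[of ?A t v i] act_superset[of ?A "s + t" v i] keys_add[of s t]
    by (simp add: lookup_add distrib_right sum.distrib)
qed

lemma act_single: "act (Poly_Mapping.single (Word w) k) v = (\<lambda>i. k * foldr L w v i)"
  by (rule ext) (simp add: act_def)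

lemma act_zero [simp]: "act 0 v = (\<lambda>i. 0)"
  by (rule ext) (simp add: act_def)

lemma act_one [simp]: "act 1 v = v"
  by (rule ext) (simp add: act_def)

lemma act_free_gen: "act (free_gen x) v = L x v"
  by (simp add: free_gen_def act_single)

lemma act_free_const: "act (free_const k) v = (\<lambda>i. k * v i)"
  by (simp add: free_const_def zero_free_mon_def act_single)

lemma foldr_L_add: "foldr L u (\<lambda>i. v i + w i) = (\<lambda>i. foldr L u v i + foldr L u w i)"
  by (induction u) (simp_all add: L_add)

lemma foldr_L_scale: "foldr L u (\<lambda>i. k * v i) = (\<lambda>i. k * foldr L u v i)"
  by (induction u) (simp_all add: L_scale)

lemma act_mult: "act (s * t) v = act s (act t v)"
proof (induction s rule: free_algebra_induct)
  case (monomial u j)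
  show ?case
  proof (induction t rule: free_algebra_induct)
    case (add s t)
    then show ?case
      by (simp add: distrib_left act_plus act_single foldr_L_add fun_eq_iff)
  qed (simp add: single_Word_mult act_single foldr_L_scale mult.assoc)
qed (simp add: distrib_right act_plus)

lemma act_minus: "act (s - t) v = (\<lambda>i. act s v i - act t v i)"
  using act_plus[of "s - t" t v] by (simp add: fun_eq_iff)

lemma act_free_const_mult: "act (free_const k * t) v = (\<lambda>i. k * act t v i)"
  by (simp add: act_mult act_free_const)

lemma act_sum: "act (sum f A) v i = (\<Sum>j\<in>A. act (f j) v i)"
  by (induction A rule: infinite_finite_induct) (simp_all add: act_plus)

end

section \<open>The left regular module of \<open>D\<^sub>3(\<alpha>\<^sub>1, \<alpha>\<^sub>2)\<close>\<close>

text \<open>A vector is the coordinate function of an element with respect to \<open>x\<^sup>i a\<^sup>j c\<^sup>k\<close>, where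
  \<open>x = a - b\<close>. The operators below are left multiplication by \<open>x\<close>, \<open>a\<close> and \<open>c\<close>, read off from
  the rewriting rules \<open>a x = x\<^sup>2 - x a\<close>, \<open>c x = x c + x\<^sup>2 - 2 x a\<close>,
  \<open>c a = (\<alpha>\<^sub>2 - \<alpha>\<^sub>1) - a c + x c + x\<^sup>2 - x a\<close> and \<open>x\<^sup>3 = (3 \<alpha>\<^sub>1 - \<alpha>\<^sub>2) x\<close>. Coordinates outside
  \<open>D3_index\<close> are irrelevant.\<close>

definition D3_index :: "(nat \<times> nat \<times> nat) set" where
  "D3_index = {..2} \<times> {..1} \<times> {..1}"

definition mult_x :: "'k::field \<Rightarrow> 'k \<Rightarrow> (nat \<times> nat \<times> nat \<Rightarrow> 'k) \<Rightarrow> nat \<times> nat \<times> nat \<Rightarrow> 'k" where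
  "mult_x \<alpha>\<^sub>1 \<alpha>\<^sub>2 v = (\<lambda>(i, j, k).
     if i = 0 then 0 else if i = 1 then v (0, j, k) + (3 * \<alpha>\<^sub>1 - \<alpha>\<^sub>2) * v (2, j, k) else v (1, j, k))"

text \<open>From \<open>a x = x^2 - x a\<close> it follows that \<open>a x^2 = x^2 a\<close>. The
  first summand and the sign -1 are therefore confined to \<open>i = 1\<close>; the factor
  \<open>\<alpha>\<^sub>1\<close> comes from reducing \<open>a^2\<close>.\<close>

definition mult_a :: "'k::field \<Rightarrow> (nat \<times> nat \<times> nat \<Rightarrow> 'k) \<Rightarrow> nat \<times> nat \<times> nat \<Rightarrow> 'k" where
  "mult_a \<alpha>\<^sub>1 v = (\<lambda>(i, j, k).
     (if i = 2 then v (1, j, k) else 0)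
     + (if j = 0 then \<alpha>\<^sub>1 else 1) * (if i = 1 then - 1 else 1) * v (i, 1 - j, k))"

text \<open>Since \<open>c\<close> commutes with \<open>x^2\<close>, the product of \<open>c\<close>
  and \<open>x^i w\<close> is \<open>x^i (c w)\<close>, plus \<open>x^2 w - 2 x a w\<close> if
  \<open>i = 1\<close>. The four branches collect, for each \<open>a^j c^k\<close>, the
  contributions of \<open>c w\<close> and of \<open>- 2 x a w\<close>. The products by
  \<open>x\<close> and \<open>x^2\<close> that arise from rewriting \<open>c a\<close> can be taken
  on the far left, because they commute with \<open>x^i\<close>; this is why the coordinate vectors
  of \<open>x v\<close> and \<open>x^2 v\<close> appear.\<close>

definition mult_c :: "'k::field \<Rightarrow> 'k \<Rightarrow> (nat \<times> nat \<times> nat \<Rightarrow> 'k) \<Rightarrow> nat \<times> nat \<times> nat \<Rightarrow> 'k" where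
  "mult_c \<alpha>\<^sub>1 \<alpha>\<^sub>2 v = (let x = mult_x \<alpha>\<^sub>1 \<alpha>\<^sub>2 v; xx = mult_x \<alpha>\<^sub>1 \<alpha>\<^sub>2 x; \<beta> = \<alpha>\<^sub>2 - \<alpha>\<^sub>1 in
     (\<lambda>(i, j, k). (if i = 2 then v (1, j, k) else 0) +
       (if j = 0 \<and> k = 0 then \<beta> * v (i, 1, 0) + xx (i, 1, 0) + \<alpha>\<^sub>1 * v (i, 0, 1) + \<alpha>\<^sub>1 * x (i, 1, 1)
          - (if i = 1 then 2 * \<alpha>\<^sub>1 * v (1, 1, 0) else 0)
        else if j = 1 \<and> k = 0 then - x (i, 1, 0) - \<alpha>\<^sub>1 * v (i, 1, 1)
          - (if i = 1 then 2 * v (1, 0, 0) else 0)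
        else if j = 0 then v (i, 0, 0) + x (i, 1, 0) + \<beta> * v (i, 1, 1) + xx (i, 1, 1)
          - (if i = 1 then 2 * \<alpha>\<^sub>1 * v (1, 1, 1) else 0)
        else - v (i, 1, 0) - x (i, 1, 1) - (if i = 1 then 2 * v (1, 0, 1) else 0))))"

definition D3_op :: "'k::field \<Rightarrow> 'k \<Rightarrow> gen3 \<Rightarrow> (nat \<times> nat \<times> nat \<Rightarrow> 'k) \<Rightarrow> nat \<times> nat \<times> nat \<Rightarrow> 'k" where
  "D3_op \<alpha>\<^sub>1 \<alpha>\<^sub>2 g v = (case g of
     Gen_a \<Rightarrow> mult_a \<alpha>\<^sub>1 v
   | Gen_b \<Rightarrow> (\<lambda>i. mult_a \<alpha>\<^sub>1 v i - mult_x \<alpha>\<^sub>1 \<alpha>\<^sub>2 v i)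
   | Gen_c \<Rightarrow> mult_c \<alpha>\<^sub>1 \<alpha>\<^sub>2 v)"

text \<open>The parameters stay free because the comparison of leading forms uses the action for the
  given parameters and the action for zero parameters side by side.\<close>

interpretation D3_module: free_module "D3_op \<alpha>\<^sub>1 \<alpha>\<^sub>2" for \<alpha>\<^sub>1 \<alpha>\<^sub>2 :: "'k::field"
proof
  fix g and v w :: "nat \<times> nat \<times> nat \<Rightarrow> 'k" and k
  have x: "mult_x \<alpha>\<^sub>1 \<alpha>\<^sub>2 (\<lambda>i. v i + w i) = (\<lambda>i. mult_x \<alpha>\<^sub>1 \<alpha>\<^sub>2 v i + mult_x \<alpha>\<^sub>1 \<alpha>\<^sub>2 w i)"
    "mult_x \<alpha>\<^sub>1 \<alpha>\<^sub>2 (\<lambda>i. k * v i) = (\<lambda>i. k * mult_x \<alpha>\<^sub>1 \<alpha>\<^sub>2 v i)" for v w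
    by (auto simp: mult_x_def fun_eq_iff algebra_simps)
  have a: "mult_a \<alpha>\<^sub>1 (\<lambda>i. v i + w i) = (\<lambda>i. mult_a \<alpha>\<^sub>1 v i + mult_a \<alpha>\<^sub>1 w i)"
    "mult_a \<alpha>\<^sub>1 (\<lambda>i. k * v i) = (\<lambda>i. k * mult_a \<alpha>\<^sub>1 v i)"
    by (auto simp: mult_a_def fun_eq_iff algebra_simps)
  have c: "mult_c \<alpha>\<^sub>1 \<alpha>\<^sub>2 (\<lambda>i. v i + w i) = (\<lambda>i. mult_c \<alpha>\<^sub>1 \<alpha>\<^sub>2 v i + mult_c \<alpha>\<^sub>1 \<alpha>\<^sub>2 w i)"
    "mult_c \<alpha>\<^sub>1 \<alpha>\<^sub>2 (\<lambda>i. k * v i) = (\<lambda>i. k * mult_c \<alpha>\<^sub>1 \<alpha>\<^sub>2 v i)"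
    by (auto simp: mult_c_def Let_def x fun_eq_iff algebra_simps)
  show "D3_op \<alpha>\<^sub>1 \<alpha>\<^sub>2 g (\<lambda>i. v i + w i) = (\<lambda>i. D3_op \<alpha>\<^sub>1 \<alpha>\<^sub>2 g v i + D3_op \<alpha>\<^sub>1 \<alpha>\<^sub>2 g w i)"
    by (cases g) (simp_all add: D3_op_def a x c add_diff_add)
  show "D3_op \<alpha>\<^sub>1 \<alpha>\<^sub>2 g (\<lambda>i. k * v i) = (\<lambda>i. k * D3_op \<alpha>\<^sub>1 \<alpha>\<^sub>2 g v i)"
    by (cases g) (simp_all add: D3_op_def a x c right_diff_distrib)
qed

lemma D3_indices: "D3_index = {(0,0,0), (0,0,1), (0,1,0), (0,1,1), (1,0,0), (1,0,1), (1,1,0), (1,1,1),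
    (2,0,0), (2,0,1), (2,1,0), (2,1,1)}"
proof -
  have "{..2::nat} = {0, 1, 2}" "{..1::nat} = {0, 1}"
    by auto
  then show ?thesis
    unfolding D3_index_def by simp
qed

text \<open>This finite check takes the place of a confluence proof: five relators, twelve
  coordinates, and an arbitrary vector \<open>v\<close>.\<close>

lemma D3_relator_act:
  assumes "r \<in> D3_relators \<alpha>\<^sub>1 \<alpha>\<^sub>2" "i \<in> D3_index"
  shows "D3_module.act \<alpha>\<^sub>1 \<alpha>\<^sub>2 r v i = 0"
proof -
  have "\<forall>i\<in>D3_index. \<forall>r\<in>D3_relators \<alpha>\<^sub>1 \<alpha>\<^sub>2. D3_module.act \<alpha>\<^sub>1 \<alpha>\<^sub>2 r v i = 0"
    unfolding D3_indices
    by (simp add: D3_relators_def Let_def D3_module.act_minus D3_module.act_plus D3_module.act_mult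
        D3_module.act_free_gen D3_module.act_free_const D3_op_def mult_a_def mult_x_def mult_c_def)
      (simp add: algebra_simps)
  then show ?thesis using assms by blast
qed

abbreviation "D3_deg \<equiv> (\<lambda>(i, j, k). i + j + k :: nat)"

definition D3_coord :: "'k::field \<Rightarrow> 'k \<Rightarrow> (gen3 free_mon \<Rightarrow>\<^sub>0 'k) \<Rightarrow> nat \<times> nat \<times> nat \<Rightarrow> 'k" where
  "D3_coord \<alpha>\<^sub>1 \<alpha>\<^sub>2 t = D3_module.act \<alpha>\<^sub>1 \<alpha>\<^sub>2 t (\<lambda>i. if i = (0, 0, 0) then 1 else 0)"

definition D3_elem :: "nat \<times> nat \<times> nat \<Rightarrow> (gen3 free_mon \<Rightarrow>\<^sub>0 'k::field)" where
  "D3_elem = (\<lambda>(i, j, k). (free_gen Gen_a - free_gen Gen_b) ^ i * free_gen Gen_a ^ j * free_gen Gen_c ^ k)"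

lemma D3_module_act_diff_gen:
  "D3_module.act \<alpha>\<^sub>1 \<alpha>\<^sub>2 (free_gen Gen_a - free_gen Gen_b) v = mult_x \<alpha>\<^sub>1 \<alpha>\<^sub>2 v"
  by (rule ext) (simp add: D3_module.act_minus D3_module.act_free_gen D3_op_def)

text \<open>Acting on the vector of 1 by powers of \<open>c\<close>, then \<open>a\<close>, then
  \<open>x\<close> within the allowed ranges builds the monomial directly, without any
  reduction.\<close>

lemma D3_coord_elem:
  assumes "i \<in> D3_index" "j \<in> D3_index"
  shows "D3_coord \<alpha>\<^sub>1 \<alpha>\<^sub>2 (D3_elem j) i = (if i = j then 1 else 0)"
proof -
  have "\<forall>j\<in>D3_index. \<forall>i\<in>D3_index. D3_coord \<alpha>\<^sub>1 \<alpha>\<^sub>2 (D3_elem j) i = (if i = j then 1 else 0)"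
    unfolding D3_indices
    by (simp add: D3_coord_def D3_elem_def D3_module.act_mult D3_module_act_diff_gen power2_eq_square
        D3_module.act_free_gen D3_op_def mult_a_def mult_x_def mult_c_def Let_def)
  then show ?thesis using assms by blast
qed

lemma D3_coord_sum:
  assumes "i \<in> D3_index"
  shows "D3_coord \<alpha>\<^sub>1 \<alpha>\<^sub>2 (\<Sum>j\<in>D3_index. free_const (p j) * D3_elem j) i = p i"
proof -
  have "D3_coord \<alpha>\<^sub>1 \<alpha>\<^sub>2 (\<Sum>j\<in>D3_index. free_const (p j) * D3_elem j) i
      = (\<Sum>j\<in>D3_index. p j * D3_coord \<alpha>\<^sub>1 \<alpha>\<^sub>2 (D3_elem j) i)"
    by (simp add: D3_coord_def D3_module.act_sum D3_module.act_free_const_mult)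
  also have "\<dots> = (\<Sum>j\<in>D3_index. if j = i then p j else 0)"
    by (rule sum.cong) (auto simp: D3_coord_elem assms)
  also have "\<dots> = p i"
    using assms by (simp add: D3_index_def)
  finally show ?thesis .
qed

lemma D3_coord_diff: "D3_coord \<alpha>\<^sub>1 \<alpha>\<^sub>2 (s - t) i = D3_coord \<alpha>\<^sub>1 \<alpha>\<^sub>2 s i - D3_coord \<alpha>\<^sub>1 \<alpha>\<^sub>2 t i"
  by (simp add: D3_coord_def D3_module.act_minus)

lemma ideal_D3_ideal: "ideal (D3_ideal \<alpha>\<^sub>1 \<alpha>\<^sub>2) free_algebra"
  unfolding D3_ideal_def
  by (rule ring.genideal_ideal[OF ring_free_algebra]) (simp add: free_algebra_def)

text \<open>The true module is the space of functions modulo those that vanish on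
  \<open>D3_index\<close>. The operators are well defined on this quotient, because their
  coordinates in \<open>D3_index\<close> only read coordinates in \<open>D3_index\<close>.\<close>

lemma D3_op_vanish:
  assumes "\<And>i. i \<in> D3_index \<Longrightarrow> v i = 0" "i \<in> D3_index"
  shows "D3_op \<alpha>\<^sub>1 \<alpha>\<^sub>2 g v i = 0"
proof -
  have "\<forall>i\<in>D3_index. D3_op \<alpha>\<^sub>1 \<alpha>\<^sub>2 g v i = 0"
    using assms(1) unfolding D3_indices
    by (cases g) (simp_all add: D3_op_def mult_a_def mult_x_def mult_c_def Let_def)
  then show ?thesis using assms(2) by blast
qed

lemma D3_act_vanish:
  assumes "\<And>i. i \<in> D3_index \<Longrightarrow> v i = 0" "i \<in> D3_index"
  shows "D3_module.act \<alpha>\<^sub>1 \<alpha>\<^sub>2 t v i = 0"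
proof -
  have "foldr (D3_op \<alpha>\<^sub>1 \<alpha>\<^sub>2) w v i = 0" if "i \<in> D3_index" for w i
    using that
  proof (induction w arbitrary: i)
    case (Cons g w)
    then show ?case using D3_op_vanish[of "foldr (D3_op \<alpha>\<^sub>1 \<alpha>\<^sub>2) w v"] by simp
  qed (use assms(1) in simp)
  then show ?thesis using assms(2) by (simp add: D3_module.act_def)
qed

lemma D3_ideal_act:
  assumes "t \<in> D3_ideal \<alpha>\<^sub>1 \<alpha>\<^sub>2" "i \<in> D3_index"
  shows "D3_module.act \<alpha>\<^sub>1 \<alpha>\<^sub>2 t v i = 0"
proof -
  \<comment> \<open>The annihilator of the module is an ideal: closure under right multiplication is
    due to the quantifier over all \<open>v\<close>, closure under left multiplication to
    \<open>D3_act_vanish\<close>.\<close>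
  let ?J = "{t. \<forall>v. \<forall>i\<in>D3_index. D3_module.act \<alpha>\<^sub>1 \<alpha>\<^sub>2 t v i = 0}"
  have "ideal ?J free_algebra"
    by (rule ideal_free_algebraI)
      (auto simp: D3_module.act_minus D3_module.act_mult intro: D3_act_vanish)
  then have "D3_ideal \<alpha>\<^sub>1 \<alpha>\<^sub>2 \<subseteq> ?J"
    unfolding D3_ideal_def
    by (rule ring.genideal_minimal[OF ring_free_algebra]) (use D3_relator_act in blast)
  then show ?thesis using assms by blast
qed

section \<open>Rewriting rules derived from the defining relations\<close>

lemma free_gen_const_commute:
  "free_gen g * free_const k = free_const k * free_gen g"
  "free_gen g * (free_const k * t) = free_const k * (free_gen g * t)"
  by (simp_all add: free_const_commute flip: mult.assoc)

text \<open>Each difference of the two sides of a rule is an explicit combination of the relators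
  \<open>r1\<close> to \<open>r5\<close>, found by substituting \<open>b = a - x\<close>. The rules
  push \<open>x\<close> to the left.\<close>

lemma D3_rewrite:
  fixes \<alpha>\<^sub>1 \<alpha>\<^sub>2 :: "'k::field"
  defines "a \<equiv> free_gen Gen_a" and "b \<equiv> free_gen Gen_b" and "c \<equiv> free_gen Gen_c"
  defines "x \<equiv> a - b"
  defines "J \<equiv> D3_ideal \<alpha>\<^sub>1 \<alpha>\<^sub>2"
  shows "a * a - free_const \<alpha>\<^sub>1 \<in> J" "c * c - free_const \<alpha>\<^sub>1 \<in> J"
    and "a * x - (x * x - x * a) \<in> J"
    and "c * a - (free_const (\<alpha>\<^sub>2 - \<alpha>\<^sub>1) - a * c + x * c + x * x - x * a) \<in> J"
    and "c * x - (x * c + x * x - x * a - x * a) \<in> J"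
    and "x * x * x - free_const (3 * \<alpha>\<^sub>1 - \<alpha>\<^sub>2) * x \<in> J"
proof -
  note ideal = ideal_D3_ideal[of \<alpha>\<^sub>1 \<alpha>\<^sub>2, folded J_def]
  note add = ideal_free_algebra_add[OF ideal] and diff = ideal_free_algebra_diff[OF ideal]
    and left = ideal_free_algebra_mult_left[OF ideal] and right = ideal_free_algebra_mult_right[OF ideal]
  define r1 where "r1 = a * a - free_const \<alpha>\<^sub>1"
  define r2 where "r2 = b * b - free_const \<alpha>\<^sub>1"
  define r3 where "r3 = c * c - free_const \<alpha>\<^sub>1"
  define r4 where "r4 = c * a + b * c + a * b - free_const \<alpha>\<^sub>2"
  define r5 where "r5 = c * b + b * a + a * c - free_const \<alpha>\<^sub>2"
  have "D3_relators \<alpha>\<^sub>1 \<alpha>\<^sub>2 \<subseteq> J"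
    unfolding J_def D3_ideal_def
    by (rule ring.genideal_self[OF ring_free_algebra]) (simp add: free_algebra_def)
  then have r: "r1 \<in> J" "r2 \<in> J" "r3 \<in> J" "r4 \<in> J" "r5 \<in> J"
    by (simp_all add: D3_relators_def Let_def r1_def r2_def r3_def r4_def r5_def a_def b_def c_def)
  then show "a * a - free_const \<alpha>\<^sub>1 \<in> J" "c * c - free_const \<alpha>\<^sub>1 \<in> J"
    by (simp_all add: r1_def r3_def)
  have "a * x - (x * x - x * a) = r1 - r2"
    by (simp add: x_def r1_def r2_def algebra_simps)
  then show ax: "a * x - (x * x - x * a) \<in> J"
    using diff r by simp
  have "c * a - (free_const (\<alpha>\<^sub>2 - \<alpha>\<^sub>1) - a * c + x * c + x * x - x * a)
      = r4 - r1 + (a * x - (x * x - x * a))"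
    by (simp add: x_def r1_def r4_def free_const_diff algebra_simps)
  then show ca: "c * a - (free_const (\<alpha>\<^sub>2 - \<alpha>\<^sub>1) - a * c + x * c + x * x - x * a) \<in> J"
    using add[OF diff[OF r(4) r(1)] ax] by (simp only:)
  have "c * x - (x * c + x * x - x * a - x * a)
      = (c * a - (free_const (\<alpha>\<^sub>2 - \<alpha>\<^sub>1) - a * c + x * c + x * x - x * a)) - r5 + r1"
    by (simp add: x_def r1_def r5_def free_const_diff algebra_simps)
  then show "c * x - (x * c + x * x - x * a - x * a) \<in> J"
    using add[OF diff[OF ca r(5)] r(1)] by (simp only:)
  \<comment> \<open>The first bracket reduces the squares in \<open>(a - b)^3\<close> and leaves
    \<open>3 \<alpha>\<^sub>1 (a - b) - (a b a - b a b)\<close>. The second one equals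
    \<open>a b a - b a b - \<alpha>\<^sub>2 (a - b)\<close>: in \<open>r4 * a - b * r4\<close> the
    terms \<open>b c a\<close> cancel.\<close>
  have "x * x * x - free_const (3 * \<alpha>\<^sub>1 - \<alpha>\<^sub>2) * x
      = (a * r1 - r1 * b + a * r2 - b * r1 + r2 * a - b * r2) - (r4 * a - b * r4 - c * r1 + r2 * c)"
  proof -
    have *: "free_const (3 * \<alpha>\<^sub>1 - \<alpha>\<^sub>2) = free_const \<alpha>\<^sub>1 + free_const \<alpha>\<^sub>1 + free_const \<alpha>\<^sub>1 - free_const \<alpha>\<^sub>2"
      by (simp flip: free_const_add free_const_diff)
    show ?thesis
      unfolding * by (simp add: x_def r1_def r2_def r4_def a_def b_def c_def algebra_simps free_gen_const_commute)
  qed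
  moreover have "(a * r1 - r1 * b + a * r2 - b * r1 + r2 * a - b * r2) - (r4 * a - b * r4 - c * r1 + r2 * c) \<in> J"
    by (intro diff add left right r)
  ultimately show "x * x * x - free_const (3 * \<alpha>\<^sub>1 - \<alpha>\<^sub>2) * x \<in> J"
    by (simp only:)
qed

section \<open>Spanning by the normal forms\<close>

definition D3_spanned :: "'k::field \<Rightarrow> 'k \<Rightarrow> (gen3 free_mon \<Rightarrow>\<^sub>0 'k) set" where
  "D3_spanned \<alpha>\<^sub>1 \<alpha>\<^sub>2 = {t. \<exists>p. t - (\<Sum>i\<in>D3_index. free_const (p i) * D3_elem i) \<in> D3_ideal \<alpha>\<^sub>1 \<alpha>\<^sub>2}"

context
  fixes \<alpha>\<^sub>1 \<alpha>\<^sub>2 :: "'k::field"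
begin

private abbreviation "J \<equiv> D3_ideal \<alpha>\<^sub>1 \<alpha>\<^sub>2"
private abbreviation "M \<equiv> D3_spanned \<alpha>\<^sub>1 \<alpha>\<^sub>2"
private abbreviation "a \<equiv> free_gen Gen_a :: gen3 free_mon \<Rightarrow>\<^sub>0 'k"
private abbreviation "b \<equiv> free_gen Gen_b :: gen3 free_mon \<Rightarrow>\<^sub>0 'k"
private abbreviation "c \<equiv> free_gen Gen_c :: gen3 free_mon \<Rightarrow>\<^sub>0 'k"
private abbreviation "x \<equiv> a - b"

private lemmas J_zero = ideal_free_algebra_zero[OF ideal_D3_ideal[of \<alpha>\<^sub>1 \<alpha>\<^sub>2]]
  and J_add = ideal_free_algebra_add[OF ideal_D3_ideal[of \<alpha>\<^sub>1 \<alpha>\<^sub>2]]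
  and J_diff = ideal_free_algebra_diff[OF ideal_D3_ideal[of \<alpha>\<^sub>1 \<alpha>\<^sub>2]]
  and J_left = ideal_free_algebra_mult_left[OF ideal_D3_ideal[of \<alpha>\<^sub>1 \<alpha>\<^sub>2]]
  and J_right = ideal_free_algebra_mult_right[OF ideal_D3_ideal[of \<alpha>\<^sub>1 \<alpha>\<^sub>2]]

private lemma spanned_ideal: "t \<in> J \<Longrightarrow> t \<in> M"
  unfolding D3_spanned_def by (auto intro!: exI[of _ "\<lambda>_. 0"])

private lemma spanned_add: "s \<in> M \<Longrightarrow> t \<in> M \<Longrightarrow> s + t \<in> M"
proof -
  assume "s \<in> M" "t \<in> M"
  then obtain p q where "s - (\<Sum>i\<in>D3_index. free_const (p i) * D3_elem i) \<in> J"
    "t - (\<Sum>i\<in>D3_index. free_const (q i) * D3_elem i) \<in> J"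
    by (auto simp: D3_spanned_def)
  then have "s + t - (\<Sum>i\<in>D3_index. free_const (p i + q i) * D3_elem i) \<in> J"
    using J_add by (fastforce simp: free_const_add distrib_right sum.distrib add_diff_add)
  then show "s + t \<in> M"
    by (auto simp: D3_spanned_def)
qed

private lemma spanned_scale: "t \<in> M \<Longrightarrow> free_const k * t \<in> M"
proof -
  assume "t \<in> M"
  then obtain p where "t - (\<Sum>i\<in>D3_index. free_const (p i) * D3_elem i) \<in> J"
    by (auto simp: D3_spanned_def)
  then have "free_const k * t - (\<Sum>i\<in>D3_index. free_const (k * p i) * D3_elem i) \<in> J"
    using J_left[of _ "free_const k"]
    by (fastforce simp: free_const_mult right_diff_distrib sum_distrib_left mult.assoc)
  then show "free_const k * t \<in> M"
    unfolding D3_spanned_def by (intro CollectI exI[of _ "\<lambda>i. k * p i"])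
qed

private lemma spanned_diff: "s \<in> M \<Longrightarrow> t \<in> M \<Longrightarrow> s - t \<in> M"
  using spanned_add[of s "free_const (- 1) * t"] spanned_scale[of t "- 1"]
  by (simp add: free_const_uminus)

private lemma spanned_cong: "s - t \<in> J \<Longrightarrow> t \<in> M \<Longrightarrow> s \<in> M"
  using spanned_add[of "s - t" t] spanned_ideal by simp

private lemma spanned_elem:
  assumes "i \<in> D3_index"
  shows "D3_elem i \<in> M"
proof -
  have "(\<Sum>j\<in>D3_index. free_const (if j = i then 1 else 0) * D3_elem j)
      = (\<Sum>j\<in>D3_index. if j = i then D3_elem j else (0 :: gen3 free_mon \<Rightarrow>\<^sub>0 'k))"
    by (rule sum.cong) auto
  also have "\<dots> = D3_elem i"
    using assms by (simp add: D3_index_def)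
  finally have "D3_elem i - (\<Sum>j\<in>D3_index. free_const (if j = i then 1 else 0) * D3_elem j) \<in> J"
    using J_zero by simp
  then show ?thesis
    unfolding D3_spanned_def by (intro CollectI exI)
qed

private lemma spanned_mult_left:
  assumes "\<And>i. i \<in> D3_index \<Longrightarrow> s * D3_elem i \<in> M" "t \<in> M"
  shows "s * t \<in> M"
proof -
  obtain p where p: "t - (\<Sum>i\<in>D3_index. free_const (p i) * D3_elem i) \<in> J"
    using assms(2) by (auto simp: D3_spanned_def)
  have "(\<Sum>i\<in>A. free_const (p i) * (s * D3_elem i)) \<in> M" if "A \<subseteq> D3_index" for A
    using that
    by (induction A rule: infinite_finite_induct)
      (simp_all add: spanned_ideal J_zero spanned_add spanned_scale assms(1))
  then have "s * (\<Sum>i\<in>D3_index. free_const (p i) * D3_elem i) \<in> M"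
    by (simp add: sum_distrib_left free_const_commute flip: mult.assoc)
  moreover have "s * t - s * (\<Sum>i\<in>D3_index. free_const (p i) * D3_elem i) \<in> J"
    using J_left[OF p, of s] by (simp only: right_diff_distrib)
  ultimately show ?thesis by (rule spanned_cong[rotated])
qed

private lemma spanned_x: "t \<in> M \<Longrightarrow> x * t \<in> M"
proof (erule spanned_mult_left[rotated])
  fix l assume "l \<in> D3_index"
  then obtain i j k where l: "l = (i, j, k)" and ijk: "i \<le> 2" "j \<le> 1" "k \<le> 1"
    by (auto simp: D3_index_def)
  show "x * D3_elem l \<in> M"
  proof (cases "i = 2")
    case False
    then have "D3_elem (Suc i, j, k) \<in> M"
      using ijk by (intro spanned_elem) (simp add: D3_index_def)
    then show ?thesis by (simp add: l D3_elem_def mult.assoc)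
  next
    case True
    let ?w = "a ^ j * c ^ k"
    \<comment> \<open>Only the exponent 2 overflows, and the cubic relation brings
      \<open>x^3\<close> back to a multiple of \<open>x\<close>.\<close>
    have "x * D3_elem l - free_const (3 * \<alpha>\<^sub>1 - \<alpha>\<^sub>2) * D3_elem (1, j, k)
        = (x * x * x - free_const (3 * \<alpha>\<^sub>1 - \<alpha>\<^sub>2) * x) * ?w"
      by (simp add: l True D3_elem_def power2_eq_square mult.assoc left_diff_distrib)
    moreover have "D3_elem (1, j, k) \<in> M"
      using ijk by (intro spanned_elem) (simp add: D3_index_def)
    ultimately show ?thesis
      using spanned_cong[OF _ spanned_scale] J_right[OF D3_rewrite(6)] by metis
  qed
qed

text \<open>The second assumption moves \<open>s\<close> past one factor \<open>x\<close>, so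
  induction on the power of \<open>x\<close> leaves only the products with \<open>a^j c^k\<close>.
  The induction carries membership of the element itself along, because the rules need it.\<close>

private lemma spanned_gen_elem:
  assumes "\<And>j k. j \<le> 1 \<Longrightarrow> k \<le> 1 \<Longrightarrow> s * (a ^ j * c ^ k) \<in> M"
    and "\<And>t. t \<in> M \<Longrightarrow> s * t \<in> M \<Longrightarrow> s * (x * t) \<in> M"
  shows "t \<in> M \<Longrightarrow> s * t \<in> M"
proof (erule spanned_mult_left[rotated])
  fix l assume "l \<in> D3_index"
  then obtain i j k where l: "l = (i, j, k)" and ijk: "i \<le> 2" "j \<le> 1" "k \<le> 1"
    by (auto simp: D3_index_def)
  have "x ^ i * (a ^ j * c ^ k) \<in> M \<and> s * (x ^ i * (a ^ j * c ^ k)) \<in> M" for i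
  proof (induction i)
    case 0
    then show ?case
      using spanned_elem[of "(0, j, k)"] assms(1) ijk by (simp add: D3_elem_def D3_index_def)
  next
    case (Suc i)
    then show ?case
      using spanned_x assms(2) by (simp add: mult.assoc)
  qed
  then show "s * D3_elem l \<in> M"
    by (simp add: l D3_elem_def mult.assoc)
qed

private lemma spanned_a: "t \<in> M \<Longrightarrow> a * t \<in> M"
proof (erule spanned_gen_elem[rotated 2])
  fix j k :: nat assume "j \<le> 1" "k \<le> 1"
  then consider "j = 0" | "j = 1" by linarith
  then show "a * (a ^ j * c ^ k) \<in> M"
  proof cases
    case 1
    then show ?thesis
      using spanned_elem[of "(0, 1, k)"] \<open>k \<le> 1\<close> by (simp add: D3_elem_def D3_index_def)
  next
    case 2
    have "free_const \<alpha>\<^sub>1 * c ^ k \<in> M"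
      using spanned_scale[OF spanned_elem[of "(0, 0, k)"]] \<open>k \<le> 1\<close> by (simp add: D3_elem_def D3_index_def)
    then show ?thesis
      using spanned_cong[of "a * (a ^ j * c ^ k)" "free_const \<alpha>\<^sub>1 * c ^ k"]
        J_right[OF D3_rewrite(1), of "c ^ k"] 2 by (simp add: left_diff_distrib mult.assoc)
  qed
next
  fix t assume t: "t \<in> M" "a * t \<in> M"
  have "x * (x * t) - x * (a * t) \<in> M"
    by (intro spanned_diff spanned_x t)
  moreover have "a * (x * t) - (x * (x * t) - x * (a * t)) \<in> J"
    using J_right[OF D3_rewrite(3), of t] by (simp only: left_diff_distrib mult.assoc)
  ultimately show "a * (x * t) \<in> M" by (rule spanned_cong[rotated])
qed

text \<open>The order \<open>x\<close>, \<open>a\<close>, \<open>c\<close> matters: the rules for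
  \<open>c x\<close> and \<open>c a\<close> produce products that begin with \<open>x\<close> or
  \<open>a\<close>, under which the set is already known to be stable.\<close>

private lemma spanned_c: "t \<in> M \<Longrightarrow> c * t \<in> M"
proof (erule spanned_gen_elem[rotated 2])
  have one: "1 \<in> M" and c: "c \<in> M"
    using spanned_elem[of "(0, 0, 0)"] spanned_elem[of "(0, 0, 1)"] by (simp_all add: D3_elem_def D3_index_def)
  have cc: "c * c \<in> M"
    using spanned_cong[OF D3_rewrite(2) spanned_scale[OF one, of \<alpha>\<^sub>1, simplified]] .
  \<comment> \<open>Used for \<open>t = 1\<close> and \<open>t = c\<close>, the two cases in which
    \<open>c\<close> meets a factor \<open>a\<close> after all powers of \<open>x\<close> are
    gone.\<close>
  have ca: "c * (a * t) \<in> M" if "t \<in> M" "c * t \<in> M" for t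
  proof -
    have "free_const (\<alpha>\<^sub>2 - \<alpha>\<^sub>1) * t - a * (c * t) + x * (c * t) + x * (x * t) - x * (a * t) \<in> M"
      by (intro spanned_add spanned_diff spanned_scale spanned_x spanned_a that)
    moreover have "c * (a * t)
        - (free_const (\<alpha>\<^sub>2 - \<alpha>\<^sub>1) * t - a * (c * t) + x * (c * t) + x * (x * t) - x * (a * t)) \<in> J"
      using J_right[OF D3_rewrite(4), of t] by (simp only: left_diff_distrib distrib_right mult.assoc)
    ultimately show ?thesis by (rule spanned_cong[rotated])
  qed
  fix j k :: nat assume "j \<le> 1" "k \<le> 1"
  then have "j = 0 \<or> j = 1" "k = 0 \<or> k = 1" by auto
  then show "c * (a ^ j * c ^ k) \<in> M"
    using c cc ca[OF one] ca[OF c] by auto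
next
  fix t assume t: "t \<in> M" "c * t \<in> M"
  have "x * (c * t) + x * (x * t) - x * (a * t) - x * (a * t) \<in> M"
    by (intro spanned_add spanned_diff spanned_x spanned_a t)
  moreover have "c * (x * t) - (x * (c * t) + x * (x * t) - x * (a * t) - x * (a * t)) \<in> J"
    using J_right[OF D3_rewrite(5), of t] by (simp only: left_diff_distrib distrib_right mult.assoc)
  ultimately show "c * (x * t) \<in> M" by (rule spanned_cong[rotated])
qed

lemma D3_spanned_UNIV: "t \<in> D3_spanned \<alpha>\<^sub>1 \<alpha>\<^sub>2"
proof (induction t rule: free_algebra_induct)
  case (monomial w k)
  have gen: "free_gen g * t \<in> M" if "t \<in> M" for g t
  proof (cases g)
    case Gen_b
    then show ?thesis
      using spanned_diff[OF spanned_a[OF that] spanned_x[OF that]] by (simp add: left_diff_distrib)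
  qed (use spanned_a spanned_c that in simp_all)
  have "Poly_Mapping.single (Word w) 1 \<in> M"
  proof (induction w)
    case Nil
    show ?case
      using spanned_elem[of "(0, 0, 0)"] by (simp add: D3_elem_def D3_index_def flip: zero_free_mon_def)
  next
    case (Cons g w)
    then show ?case
      using gen[of "Poly_Mapping.single (Word w) 1" g] by (simp add: free_gen_def single_Word_mult)
  qed
  then show ?case
    using spanned_scale[of "Poly_Mapping.single (Word w) 1" k] by (simp flip: single_eq_free_const_mult)
qed (rule spanned_add)

end

text \<open>For the converse, \<open>t\<close> is congruent to a combination of normal forms; as the
  ideal acts by zero, its coefficients are the coordinates of \<open>t\<close>, so they
  vanish.\<close>

lemma D3_ideal_iff: "t \<in> D3_ideal \<alpha>\<^sub>1 \<alpha>\<^sub>2 \<longleftrightarrow> (\<forall>i\<in>D3_index. D3_coord \<alpha>\<^sub>1 \<alpha>\<^sub>2 t i = 0)"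
proof
  show "\<forall>i\<in>D3_index. D3_coord \<alpha>\<^sub>1 \<alpha>\<^sub>2 t i = 0" if "t \<in> D3_ideal \<alpha>\<^sub>1 \<alpha>\<^sub>2"
    using that D3_ideal_act by (auto simp: D3_coord_def)
next
  assume zero: "\<forall>i\<in>D3_index. D3_coord \<alpha>\<^sub>1 \<alpha>\<^sub>2 t i = 0"
  obtain p where p: "t - (\<Sum>i\<in>D3_index. free_const (p i) * D3_elem i) \<in> D3_ideal \<alpha>\<^sub>1 \<alpha>\<^sub>2"
    using D3_spanned_UNIV[of t \<alpha>\<^sub>1 \<alpha>\<^sub>2] by (auto simp: D3_spanned_def)
  have "p i = 0" if "i \<in> D3_index" for i
  proof -
    have "D3_coord \<alpha>\<^sub>1 \<alpha>\<^sub>2 (t - (\<Sum>i\<in>D3_index. free_const (p i) * D3_elem i)) i = 0"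
      using D3_ideal_act[OF p that] by (simp add: D3_coord_def)
    then show ?thesis
      using zero that by (simp add: D3_coord_diff D3_coord_sum)
  qed
  then show "t \<in> D3_ideal \<alpha>\<^sub>1 \<alpha>\<^sub>2"
    using p by simp
qed

section \<open>Leading forms\<close>

text \<open>Here \<open>v0\<close> is the part of degree n of \<open>v\<close>. In the operators,
  every term with a factor \<open>\<alpha>\<^sub>1\<close> or \<open>\<alpha>\<^sub>2\<close> lowers
  the degree, while the remaining terms raise it by exactly one. All three clauses are needed
  together to pass from one word length to the next.\<close>

lemma D3_op_degree:
  assumes "\<And>i. i \<in> D3_index \<Longrightarrow> (n < D3_deg i \<longrightarrow> v i = 0) \<and> (D3_deg i = n \<longrightarrow> v i = v0 i)
      \<and> (D3_deg i \<noteq> n \<longrightarrow> v0 i = 0)"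
    and "i \<in> D3_index"
  shows "(Suc n < D3_deg i \<longrightarrow> D3_op \<alpha>\<^sub>1 \<alpha>\<^sub>2 g v i = 0)
      \<and> (D3_deg i = Suc n \<longrightarrow> D3_op \<alpha>\<^sub>1 \<alpha>\<^sub>2 g v i = D3_op 0 0 g v0 i)
      \<and> (D3_deg i \<noteq> Suc n \<longrightarrow> D3_op 0 0 g v0 i = 0)"
proof -
  have v: "v i = 0" if "n < D3_deg i" "i \<in> D3_index" for i
    using assms(1)[OF that(2)] that(1) by blast
  have eq: "v i = v0 i" if "D3_deg i = n" "i \<in> D3_index" for i
    using assms(1)[OF that(2)] that(1) by blast
  have v0: "v0 i = 0" if "D3_deg i \<noteq> n" "i \<in> D3_index" for i
    using assms(1)[OF that(2)] that(1) by blast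
  have "\<forall>i\<in>D3_index. Suc n < D3_deg i \<longrightarrow> D3_op \<alpha>\<^sub>1 \<alpha>\<^sub>2 g v i = 0"
    unfolding D3_indices
    by (cases g) (auto simp: D3_op_def mult_a_def mult_x_def mult_c_def Let_def v D3_indices)
  moreover have "\<forall>i\<in>D3_index. D3_deg i = Suc n \<longrightarrow> D3_op \<alpha>\<^sub>1 \<alpha>\<^sub>2 g v i = D3_op 0 0 g v0 i"
    unfolding D3_indices
    by (cases g) (auto simp: D3_op_def mult_a_def mult_x_def mult_c_def Let_def v v0 eq D3_indices)
  moreover have "\<forall>i\<in>D3_index. D3_deg i \<noteq> Suc n \<longrightarrow> D3_op 0 0 g v0 i = 0"
    unfolding D3_indices
    by (cases g) (auto simp: D3_op_def mult_a_def mult_x_def mult_c_def Let_def v0 D3_indices)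
  ultimately show ?thesis using assms(2) by blast
qed

lemma D3_word_degree:
  fixes \<alpha>\<^sub>1 \<alpha>\<^sub>2 :: "'k::field"
  assumes "i \<in> D3_index"
  shows "(length w < D3_deg i \<longrightarrow> D3_coord \<alpha>\<^sub>1 \<alpha>\<^sub>2 (Poly_Mapping.single (Word w) 1) i = 0)
      \<and> (D3_deg i = length w \<longrightarrow> D3_coord \<alpha>\<^sub>1 \<alpha>\<^sub>2 (Poly_Mapping.single (Word w) 1) i
            = D3_coord 0 0 (Poly_Mapping.single (Word w) 1) i)
      \<and> (D3_deg i \<noteq> length w \<longrightarrow> D3_coord 0 0 (Poly_Mapping.single (Word w) (1 :: 'k)) i = 0)"
  using assms
proof (induction w arbitrary: i)
  case Nil
  then show ?case
    by (auto simp: D3_coord_def D3_module.act_single)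
next
  case (Cons g w)
  have "D3_coord \<beta>\<^sub>1 \<beta>\<^sub>2 (Poly_Mapping.single (Word (g # w)) 1)
      = D3_op \<beta>\<^sub>1 \<beta>\<^sub>2 g (D3_coord \<beta>\<^sub>1 \<beta>\<^sub>2 (Poly_Mapping.single (Word w) 1))" for \<beta>\<^sub>1 \<beta>\<^sub>2 :: 'k
    by (simp add: D3_coord_def D3_module.act_single)
  then show ?case
    using D3_op_degree[OF Cons.IH Cons.prems] by simp
qed

lemma D3_coord_expand:
  "D3_coord \<alpha>\<^sub>1 \<alpha>\<^sub>2 t i
    = (\<Sum>w\<in>Poly_Mapping.keys t. Poly_Mapping.lookup t w * D3_coord \<alpha>\<^sub>1 \<alpha>\<^sub>2 (Poly_Mapping.single w 1) i)"
proof -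
  have "D3_coord \<alpha>\<^sub>1 \<alpha>\<^sub>2 (Poly_Mapping.single w 1)
      = foldr (D3_op \<alpha>\<^sub>1 \<alpha>\<^sub>2) (letters w) (\<lambda>i. if i = (0, 0, 0) then 1 else 0)" for w
    using D3_module.act_single[of \<alpha>\<^sub>1 \<alpha>\<^sub>2 "letters w" 1] by (simp add: D3_coord_def)
  then show ?thesis
    by (simp add: D3_coord_def D3_module.act_def)
qed

lemma D3_coord_deg_lt:
  assumes "t \<in> deg_lt n" "i \<in> D3_index" "n \<le> D3_deg i"
  shows "D3_coord \<alpha>\<^sub>1 \<alpha>\<^sub>2 t i = 0"
  unfolding D3_coord_expand[of \<alpha>\<^sub>1 \<alpha>\<^sub>2 t]
proof (rule sum.neutral, rule ballI)
  fix w assume "w \<in> Poly_Mapping.keys t"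
  then have "length (letters w) < D3_deg i"
    using assms by (auto simp: deg_lt_def)
  then show "Poly_Mapping.lookup t w * D3_coord \<alpha>\<^sub>1 \<alpha>\<^sub>2 (Poly_Mapping.single w 1) i = 0"
    using D3_word_degree[OF assms(2), of "letters w" \<alpha>\<^sub>1 \<alpha>\<^sub>2] by simp
qed

lemma D3_coord_leading:
  assumes "t \<in> homog n" "i \<in> D3_index" "D3_deg i = n"
  shows "D3_coord \<alpha>\<^sub>1 \<alpha>\<^sub>2 t i = D3_coord 0 0 t i"
  unfolding D3_coord_expand[of \<alpha>\<^sub>1 \<alpha>\<^sub>2 t] D3_coord_expand[of 0 0 t]
proof (rule sum.cong[OF refl])
  fix w assume "w \<in> Poly_Mapping.keys t"
  then have "D3_deg i = length (letters w)"
    using assms by (auto simp: homog_def)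
  then show "Poly_Mapping.lookup t w * D3_coord \<alpha>\<^sub>1 \<alpha>\<^sub>2 (Poly_Mapping.single w 1) i
      = Poly_Mapping.lookup t w * D3_coord 0 0 (Poly_Mapping.single w 1) i"
    using D3_word_degree[OF assms(2), of "letters w" \<alpha>\<^sub>1 \<alpha>\<^sub>2] by simp
qed

lemma D3_coord_homog:
  fixes t :: "gen3 free_mon \<Rightarrow>\<^sub>0 'k::field"
  assumes "t \<in> homog n" "i \<in> D3_index" "D3_deg i \<noteq> n"
  shows "D3_coord 0 0 t i = 0"
  unfolding D3_coord_expand[of 0 0 t]
proof (rule sum.neutral, rule ballI)
  fix w assume "w \<in> Poly_Mapping.keys t"
  then have "D3_deg i \<noteq> length (letters w)"
    using assms by (auto simp: homog_def)
  then show "Poly_Mapping.lookup t w * D3_coord 0 0 (Poly_Mapping.single w 1) i = 0"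
    using D3_word_degree[OF assms(2), of "letters w" "0 :: 'k" 0] by simp
qed

text \<open>For zero parameters a coordinate of degree n sees only the homogeneous part of degree n,
  so the coordinates of the parts vanish as soon as those of \<open>t\<close> do.\<close>

lemma E3_ideal_homogeneous:
  assumes "t \<in> D3_ideal 0 0"
  shows "hpart n t \<in> D3_ideal 0 0"
proof -
  obtain N where N: "t \<in> deg_lt N" using deg_lt_exhaustive by blast
  have "D3_coord 0 0 (hpart n t) i = 0" if i: "i \<in> D3_index" for i
  proof (cases "D3_deg i = n")
    case False
    then show ?thesis by (rule D3_coord_homog[OF hpart_in_homog i])
  next
    case True
    have other: "D3_coord 0 0 (hpart m t) i = 0" if "m \<noteq> n" for m
      by (rule D3_coord_homog[OF hpart_in_homog i]) (use that True in simp)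
    have "D3_coord 0 0 t i = D3_coord 0 0 (\<Sum>m<N. hpart m t) i"
      by (simp add: sum_hpart[OF N])
    also have "\<dots> = (\<Sum>m<N. D3_coord 0 0 (hpart m t) i)"
      by (simp add: D3_coord_def D3_module.act_sum)
    also have "\<dots> = (\<Sum>m<N. if m = n then D3_coord 0 0 (hpart n t) i else 0)"
      by (rule sum.cong) (auto simp: other)
    also have "\<dots> = D3_coord 0 0 (hpart n t) i"
      using hpart_deg_lt[OF N, of n] by (auto simp: D3_coord_def)
    finally show ?thesis
      using assms i D3_ideal_iff by metis
  qed
  then show ?thesis by (simp add: D3_ideal_iff)
qed

lemma D3_elem_homog: "D3_elem i \<in> homog (D3_deg i)"
proof -
  have gen: "free_gen g \<in> homog (Suc 0)" for g
    by (simp add: free_gen_def)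
  have pow: "s ^ m \<in> homog m" if "s \<in> homog (Suc 0)" for s :: "gen3 free_mon \<Rightarrow>\<^sub>0 'a" and m
  proof (induction m)
    case (Suc m)
    then show ?case using homog_mult[OF that] by fastforce
  qed (simp add: homog_def)
  show ?thesis
    by (cases i) (auto simp: D3_elem_def intro!: homog_mult pow homog_diff gen)
qed

text \<open>The coordinates of degree n of a homogeneous \<open>t\<close> do not depend on the
  parameters, and elements of degree below n have none. So \<open>t\<close> can be reduced to lower
  degree modulo the deformed ideal exactly if these coordinates vanish, and for zero parameters
  \<open>t\<close> has no others.\<close>

lemma D3_leading:
  assumes t: "t \<in> homog n"
  shows "(\<exists>s\<in>deg_lt n. t - s \<in> D3_ideal \<alpha>\<^sub>1 \<alpha>\<^sub>2) \<longleftrightarrow> t \<in> D3_ideal 0 0"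
proof
  assume "\<exists>s\<in>deg_lt n. t - s \<in> D3_ideal \<alpha>\<^sub>1 \<alpha>\<^sub>2"
  then obtain s where s: "s \<in> deg_lt n" "t - s \<in> D3_ideal \<alpha>\<^sub>1 \<alpha>\<^sub>2" by blast
  have "D3_coord 0 0 t i = 0" if i: "i \<in> D3_index" for i
  proof (cases "D3_deg i = n")
    case True
    then show ?thesis
      using s i D3_coord_leading[OF t i True, of \<alpha>\<^sub>1 \<alpha>\<^sub>2] D3_coord_deg_lt[OF s(1) i, of \<alpha>\<^sub>1 \<alpha>\<^sub>2]
      by (simp add: D3_ideal_iff D3_coord_diff)
  qed (rule D3_coord_homog[OF t i])
  then show "t \<in> D3_ideal 0 0" by (simp add: D3_ideal_iff)
next
  assume "t \<in> D3_ideal 0 0"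
  then have zero: "D3_coord 0 0 t i = 0" if "i \<in> D3_index" for i
    using that by (simp add: D3_ideal_iff)
  \<comment> \<open>The witness is the normal form of \<open>t\<close> for the given parameters; its
    coordinates in degree n and above vanish, so its degree drops below n.\<close>
  define s where "s = (\<Sum>i\<in>D3_index. free_const (D3_coord \<alpha>\<^sub>1 \<alpha>\<^sub>2 t i) * D3_elem i)"
  have "free_const (D3_coord \<alpha>\<^sub>1 \<alpha>\<^sub>2 t i) * D3_elem i \<in> deg_lt n" if i: "i \<in> D3_index" for i
  proof (cases "D3_deg i < n")
    case True
    have "D3_elem i \<in> deg_lt (Suc (D3_deg i))"
      by (rule subsetD[OF homog_subset_deg_lt D3_elem_homog])
    then have "D3_elem i \<in> deg_lt n"
      by (rule subsetD[OF deg_lt_mono, rotated]) (use True in simp)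
    then show ?thesis by (rule deg_lt_free_const_mult)
  next
    case False
    have "D3_coord \<alpha>\<^sub>1 \<alpha>\<^sub>2 t i = 0"
    proof (cases "D3_deg i = n")
      case True
      then show ?thesis using D3_coord_leading[OF t i True] zero[OF i] by simp
    next
      case neq: False
      show ?thesis
        by (rule D3_coord_deg_lt[of t "Suc n"]) (use t homog_subset_deg_lt i neq False in auto)
    qed
    then show ?thesis by simp
  qed
  then have "s \<in> deg_lt n"
    unfolding s_def by (rule deg_lt_sum)
  moreover have "t - s \<in> D3_ideal \<alpha>\<^sub>1 \<alpha>\<^sub>2"
    by (simp add: D3_ideal_iff D3_coord_diff s_def D3_coord_sum)
  ultimately show "\<exists>s\<in>deg_lt n. t - s \<in> D3_ideal \<alpha>\<^sub>1 \<alpha>\<^sub>2" by blast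
qed

section \<open>Application to the quotient algebras and the stated basis\<close>

abbreviation D3_proj :: "'k::field \<Rightarrow> 'k \<Rightarrow> (gen3 free_mon \<Rightarrow>\<^sub>0 'k) \<Rightarrow> (gen3 free_mon \<Rightarrow>\<^sub>0 'k) set" where
  "D3_proj \<alpha>\<^sub>1 \<alpha>\<^sub>2 t \<equiv> D3_ideal \<alpha>\<^sub>1 \<alpha>\<^sub>2 +>\<^bsub>free_algebra\<^esub> t"

lemma presentation_D3: "presentation (D3 \<alpha>\<^sub>1 \<alpha>\<^sub>2) (D3_proj \<alpha>\<^sub>1 \<alpha>\<^sub>2)"
  unfolding D3_def by (rule presentation_quotient_algebra[OF ideal_D3_ideal])

lemma D3_proj_eq_iff: "D3_proj \<alpha>\<^sub>1 \<alpha>\<^sub>2 s = D3_proj \<alpha>\<^sub>1 \<alpha>\<^sub>2 t \<longleftrightarrow> s - t \<in> D3_ideal \<alpha>\<^sub>1 \<alpha>\<^sub>2"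
  by (rule coset_free_algebra_eq_iff[OF ideal_D3_ideal])

lemma D3_pbw_deformation:
  fixes \<alpha>\<^sub>1 \<alpha>\<^sub>2 :: "'k::field"
  shows "pbw_deformation class_ring E3 E3_grading (D3 \<alpha>\<^sub>1 \<alpha>\<^sub>2) (D3_filtration \<alpha>\<^sub>1 \<alpha>\<^sub>2)"
proof -
  have "pbw_deformation class_ring (D3 0 0) (\<lambda>n. D3_proj 0 0 ` homog n)
      (D3 \<alpha>\<^sub>1 \<alpha>\<^sub>2) (\<lambda>n. D3_proj \<alpha>\<^sub>1 \<alpha>\<^sub>2 ` deg_lt (Suc n))"
    by (rule pbw_deformation_presentation[OF presentation_D3 presentation_D3])
      (simp_all add: D3_proj_eq_iff E3_ideal_homogeneous D3_leading)
  moreover have "E3_grading = (\<lambda>n. D3_proj (0::'k) 0 ` homog n)"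
    using presentation.span_words_eq[OF presentation_D3[of "0 :: 'k" 0]]
    by (simp add: fun_eq_iff E3_grading_def E3_def D3_gen_def[abs_def])
  moreover have "D3_filtration \<alpha>\<^sub>1 \<alpha>\<^sub>2 = (\<lambda>n. D3_proj \<alpha>\<^sub>1 \<alpha>\<^sub>2 ` deg_lt (Suc n))"
    using presentation.span_words_le[OF presentation_D3[of \<alpha>\<^sub>1 \<alpha>\<^sub>2]]
    by (simp add: fun_eq_iff D3_filtration_def D3_gen_def[abs_def])
  ultimately show ?thesis by (simp add: E3_def)
qed

lemma D3_basis:
  "inj_on (\<lambda>i. D3_proj \<alpha>\<^sub>1 \<alpha>\<^sub>2 (D3_elem i)) D3_index
    \<and> vectorspace.basis class_ring (D3 \<alpha>\<^sub>1 \<alpha>\<^sub>2) ((\<lambda>i. D3_proj \<alpha>\<^sub>1 \<alpha>\<^sub>2 (D3_elem i)) ` D3_index)"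
  by (rule presentation.basis_by_coordinates[OF presentation_D3, where coord = "D3_coord \<alpha>\<^sub>1 \<alpha>\<^sub>2"])
    (simp_all add: D3_proj_eq_iff D3_ideal_iff D3_coord_diff D3_coord_sum, simp add: D3_index_def)

theorem theorem2p12:
  fixes \<alpha>\<^sub>1 \<alpha>\<^sub>2 :: "'k::alg_closed_field"
  assumes "CHAR('k) \<noteq> 2"
  shows "let D = D3 \<alpha>\<^sub>1 \<alpha>\<^sub>2;
             a = D3_gen \<alpha>\<^sub>1 \<alpha>\<^sub>2 Gen_a; b = D3_gen \<alpha>\<^sub>1 \<alpha>\<^sub>2 Gen_b; c = D3_gen \<alpha>\<^sub>1 \<alpha>\<^sub>2 Gen_c;
             I = {..2} \<times> {..1} \<times> {..1};
             e = (\<lambda>(n\<^sub>1 :: nat, n\<^sub>2 :: nat, n\<^sub>3 :: nat).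
                   (a \<ominus>\<^bsub>D\<^esub> b) [^]\<^bsub>D\<^esub> n\<^sub>1 \<otimes>\<^bsub>D\<^esub> a [^]\<^bsub>D\<^esub> n\<^sub>2 \<otimes>\<^bsub>D\<^esub> c [^]\<^bsub>D\<^esub> n\<^sub>3)
         in pbw_deformation class_ring E3 E3_grading D (D3_filtration \<alpha>\<^sub>1 \<alpha>\<^sub>2) \<and>
            inj_on e I \<and> vectorspace.basis class_ring D (e ` I)"
proof -
  interpret D: presentation "D3 \<alpha>\<^sub>1 \<alpha>\<^sub>2" "D3_proj \<alpha>\<^sub>1 \<alpha>\<^sub>2"
    by (rule presentation_D3)
  have "(\<lambda>(n\<^sub>1 :: nat, n\<^sub>2 :: nat, n\<^sub>3 :: nat).
      (D3_gen \<alpha>\<^sub>1 \<alpha>\<^sub>2 Gen_a \<ominus>\<^bsub>D3 \<alpha>\<^sub>1 \<alpha>\<^sub>2\<^esub> D3_gen \<alpha>\<^sub>1 \<alpha>\<^sub>2 Gen_b) [^]\<^bsub>D3 \<alpha>\<^sub>1 \<alpha>\<^sub>2\<^esub> n\<^sub>1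
        \<otimes>\<^bsub>D3 \<alpha>\<^sub>1 \<alpha>\<^sub>2\<^esub> D3_gen \<alpha>\<^sub>1 \<alpha>\<^sub>2 Gen_a [^]\<^bsub>D3 \<alpha>\<^sub>1 \<alpha>\<^sub>2\<^esub> n\<^sub>2
        \<otimes>\<^bsub>D3 \<alpha>\<^sub>1 \<alpha>\<^sub>2\<^esub> D3_gen \<alpha>\<^sub>1 \<alpha>\<^sub>2 Gen_c [^]\<^bsub>D3 \<alpha>\<^sub>1 \<alpha>\<^sub>2\<^esub> n\<^sub>3)
      = (\<lambda>i. D3_proj \<alpha>\<^sub>1 \<alpha>\<^sub>2 (D3_elem i))"
    by (auto simp: D3_gen_def D.minus_h D.pow_h D.mult_h D3_elem_def)
  then show ?thesis
    using D3_pbw_deformation[of \<alpha>\<^sub>1 \<alpha>\<^sub>2] D3_basis[of \<alpha>\<^sub>1 \<alpha>\<^sub>2] by (simp add: Let_def D3_index_def)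
qed

end
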